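(* Let $(q,k_0)\in\{(2,3),(3,2)\}$, let $k\ge k_0$, and put $[k]_q=\frac{q^k-1}{q-1}$. Write $n=[k]_q\cdot s+t\ge k$, where $s\in\mathbb{Z}_{\ge 0}$ and $t\in\{0,1,\ldots,[k]_q-1\}$. Assume that the minimum weight $d$ under consideration is written as $d(s,t)=q^{k-1}s+\alpha(t)$, where $\alpha(t)$ is an integer constant depending only on $t$. Let $$r=q^{k-1}([k]_q s+t)-[k]_q\, d(s,t)=q^{k-1}t-[k]_q\,\alpha(t),\qquad s'=\frac{qr-t}{[k]_q}+1,$$ which are integers not depending on $s$. Suppose that $qr\ge k$. Note that the parameters $[qr,k,(q-1)r]$ and $[[k]_q(s'-1)+t,\,k,\,q^{k-1}(s'-1)+\alpha(t)]$ coincide. (i) For every integer $s\ge s'$, there is a one-to-one correspondence between equivalence classes of LCD codes over $\mathbb{F}_q$ with dual distances $d^\perp\ge 2$ and parameters $$[qr,k,(q-1)r]=[[k]_q(s'-1)+t,\,k,\,q^{k-1}(s'-1)+\alpha(t)]$$ and equivalence classes of LCD codes over $\mathbb{F}_q$ with dual distances $d^\perp\ge 2$ and parameters $$[[k]_q s+t,\,k,\,q^{k-1}s+\alpha(t)].$$ (ii) If there is no LCD $[qr,k,(q-1)r]$ code over $\mathbb{F}_q$ with dual distance $d^\perp\ge 2$, then for every integer $s\ge s'$ there is no LCD $[[k]_q s+t,\,k,\,q^{k-1}s+\alpha(t)]$ code over $\mathbb{F}_q$ (with any dual distance).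
   Context: An $[n,k]$ code over $\mathbb{F}_q$ is a $k$-dimensional subspace $C$ of $\mathbb{F}_q^n$; an $[n,k,d]$ code is one whose minimum weight (the smallest Hamming weight of a nonzero codeword) is exactly $d$. The dual code is $C^\perp=\{x\in\mathbb{F}_q^n: x\cdot y=0 \text{ for all } y\in C\}$ for the standard inner product. $C$ is LCD (linear complementary dual) if $C\cap C^\perp=\{0\}$. The dual distance $d^\perp$ of $C$ is the minimum weight of $C^\perp$. Two $[n,k]$ codes $C_1,C_2$ over $\mathbb{F}_q$ are equivalent if $C_2=\{cP: c\in C_1\}$ for some $n\times n$ monomial matrix $P$ over $\mathbb{F}_q$ (a matrix with exactly one nonzero entry in each row and column). *)

theory Defs
  imports "Jordan_Normal_Form.VS_Connect" "HOL-Library.Extended_Nat"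
begin

text \<open>
  The field with \<open>q\<close> elements is a type \<open>'a :: {field, finite}\<close> with \<open>CARD('a) = q\<close>, and the
  vectors of length \<open>n\<close> are \<open>carrier_vec n\<close>, so that the length is an ordinary natural number.
\<close>

definition linear_code :: "nat \<Rightarrow> nat \<Rightarrow> 'a :: field vec set \<Rightarrow> bool" where
  "linear_code n k C \<longleftrightarrow>
     VectorSpace.subspace class_ring C (module_vec TYPE('a) n) \<and>
     vectorspace.dim class_ring ((module_vec TYPE('a) n)\<lparr>carrier := C\<rparr>) = k"

definition hamming_weight :: "'a :: zero vec \<Rightarrow> nat" where
  "hamming_weight v = card {i. i < dim_vec v \<and> v $ i \<noteq> 0}"

text \<open>
  The infimum is taken in \<^typ>\<open>enat\<close>: a code without nonzero codewords has minimum weight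
  \<open>\<infinity>\<close>, which concerns only the dual of the whole space.
\<close>

definition min_weight :: "'a :: zero vec set \<Rightarrow> enat" where
  "min_weight C = (INF c \<in> {c \<in> C. c \<noteq> 0\<^sub>v (dim_vec c)}. enat (hamming_weight c))"

definition dual_code :: "nat \<Rightarrow> 'a :: comm_ring_1 vec set \<Rightarrow> 'a vec set" where
  "dual_code n C = vec_module.orthogonal_complement n C"

definition LCD :: "nat \<Rightarrow> 'a :: comm_ring_1 vec set \<Rightarrow> bool" where
  "LCD n C \<longleftrightarrow> C \<inter> dual_code n C = {0\<^sub>v n}"

definition dual_distance :: "nat \<Rightarrow> 'a :: comm_ring_1 vec set \<Rightarrow> enat" where
  "dual_distance n C = min_weight (dual_code n C)"

definition lcd_codes :: "nat \<Rightarrow> nat \<Rightarrow> nat \<Rightarrow> 'a :: field vec set set" where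
  "lcd_codes n k d = {C. linear_code n k C \<and> min_weight C = enat d \<and> LCD n C}"

definition lcd_codes_dual2 :: "nat \<Rightarrow> nat \<Rightarrow> nat \<Rightarrow> 'a :: field vec set set" where
  "lcd_codes_dual2 n k d = {C \<in> lcd_codes n k d. dual_distance n C \<ge> 2}"

definition monomial_mat :: "nat \<Rightarrow> 'a :: zero mat \<Rightarrow> bool" where
  "monomial_mat n P \<longleftrightarrow> P \<in> carrier_mat n n \<and>
     (\<forall>i<n. \<exists>!j. j < n \<and> P $$ (i, j) \<noteq> 0) \<and>
     (\<forall>j<n. \<exists>!i. i < n \<and> P $$ (i, j) \<noteq> 0)"

text \<open>The row-vector product \<open>c P\<close> is written as \<open>P\<^sup>T c\<close>.\<close>

definition code_equiv :: "nat \<Rightarrow> nat \<Rightarrow> ('a :: field vec set \<times> 'a vec set) set" where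
  "code_equiv n k = {(C1, C2). linear_code n k C1 \<and> linear_code n k C2 \<and>
     (\<exists>P. monomial_mat n P \<and> C2 = (\<lambda>c. transpose_mat P *\<^sub>v c) ` C1)}"

text \<open>\<open>q_bracket q k\<close> is the number $[k]_q$; the division is exact for \<open>q \<ge> 2\<close>.\<close>

definition q_bracket :: "nat \<Rightarrow> nat \<Rightarrow> nat" where
  "q_bracket q k = (q ^ k - 1) div (q - 1)"

end

theory Submission
  imports Defs "Berlekamp_Zassenhaus.Berlekamp_Type_Based"
begin

text \<open>
The columns of a generator matrix of an \<open>[n, k]\<close> code form a list of \<open>n\<close> vectors in \<open>F_q^k\<close>, and
the codeword of a message \<open>x\<close> collects the products of \<open>x\<close> with them. Everything in the
theorem can be read off this list. The weight of a codeword is the number of columns off a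
hyperplane; dual distance at least 2 means that no column is zero; and the code has dimension
\<open>k\<close> and is LCD exactly if the Gram form \<open>(x, y) \<mapsto> \<Sum> (v \<bullet> x) (v \<bullet> y)\<close>, summed over the columns \<open>v\<close>, is
nondegenerate. A nonzero scalar of \<open>F_2\<close> or \<open>F_3\<close> has square 1, so weights and Gram form depend
only on the multiset of projective points spanned by the columns, and two codes are equivalent
exactly if a linear automorphism of \<open>F_q^k\<close> carries one multiset to the other.

A column list that contains every projective point once generates the simplex code. It has
length \<open>[k]_q\<close>, all its nonzero weights are \<open>q^(k-1)\<close>, and its Gram form vanishes
(\<open>gram_simplex_columns\<close>): the weights are divisible by 4 for \<open>q = 2\<close>, \<open>k \<ge> 3\<close>, and by 3 for
\<open>q = 3\<close>, \<open>k \<ge> 2\<close>. Adding \<open>u\<close> copies of it to a column list therefore keeps the LCD property and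
changes the length and the minimum weight by \<open>[k]_q u\<close> and \<open>q^(k-1) u\<close>. The added multiset is
invariant under all linear automorphisms and can be cancelled, so this operation preserves and
reflects equivalence (\<open>columns_equiv_add_simplex\<close>).

It is also surjective on equivalence classes. Adding up the weights of all messages that are not
orthogonal to a point \<open>p\<close> shows (\<open>multiplicity_bound\<close>) that \<open>p\<close> has multiplicity at least
\<open>q d - (q - 1) n'\<close>, where \<open>d\<close> is the minimum weight and \<open>n'\<close> the number of nonzero columns. For
\<open>n = q r + [k]_q u\<close> and \<open>d = (q - 1) r + q^(k-1) u\<close> this number is \<open>u\<close> if there is no zero column,
so \<open>u\<close> copies of every point can be taken away. With \<open>u = s - s' + 1\<close> this is part (i).

For part (ii), suppose that \<open>z\<close> columns are zero. Then every multiplicity is at least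
\<open>u + (q - 1) z\<close>, and removing the zero columns and \<open>u + (q - 1) z\<close> copies of every point leaves
\<open>q r - q^k z\<close> columns. The gap of \<open>q^k z\<close> columns is filled with \<open>q z\<close> copies of an affine
hyperplane \<open>{v. v \<bullet> \<phi> = 1}\<close>. A vector repeated a multiple of \<open>q\<close> times does not contribute to the
Gram form, and each weight grows by at least \<open>(q - 1) q^(k-1) z\<close>, with equality for messages that
are not multiples of \<open>\<phi>\<close>. Choosing \<open>\<phi>\<close> not proportional to a message of minimum weight gives
the minimum weight \<open>(q - 1) r\<close> exactly (\<open>lcd_code_imp_lcd_code_dual2\<close>).
\<close>

section \<open>Column lists of generator matrices\<close>

definition encode :: "'a :: comm_ring_1 vec list \<Rightarrow> 'a vec \<Rightarrow> 'a vec" where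
  "encode vs x = vec (length vs) (\<lambda>i. vs ! i \<bullet> x)"

definition code :: "nat \<Rightarrow> 'a :: comm_ring_1 vec list \<Rightarrow> 'a vec set" where
  "code k vs = encode vs ` carrier_vec k"

definition weight :: "'a :: comm_ring_1 vec list \<Rightarrow> 'a vec \<Rightarrow> nat" where
  "weight vs x = (\<Sum>v\<leftarrow>vs. of_bool (v \<bullet> x \<noteq> 0))"

text \<open>The bilinear form of the matrix \<open>G G\<^sup>T\<close>, where \<open>G\<close> is the generator matrix with columns \<open>vs\<close>.\<close>

definition gram :: "'a :: comm_ring_1 vec list \<Rightarrow> 'a vec \<Rightarrow> 'a vec \<Rightarrow> 'a" where
  "gram vs x y = (\<Sum>v\<leftarrow>vs. (v \<bullet> x) * (v \<bullet> y))"

definition nondegenerate :: "nat \<Rightarrow> 'a :: comm_ring_1 vec list \<Rightarrow> bool" where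
  "nondegenerate k vs \<longleftrightarrow>
     (\<forall>x\<in>carrier_vec k. (\<forall>y\<in>carrier_vec k. gram vs x y = 0) \<longrightarrow> x = 0\<^sub>v k)"

section \<open>Counting vectors over a finite field\<close>

text \<open>Translation by multiples of \<open>w\<close> permutes \<open>X\<close> and changes the value at \<open>x\<close> by an arbitrary
amount, so the \<open>q\<close> fibres of \<open>v \<mapsto> v \<bullet> x\<close> on \<open>X\<close> are in bijection with each other. The counts
of vectors on hyperplanes are instances: \<open>X\<close> is the whole space or is cut out by a condition on the
product with a second vector that is orthogonal to \<open>w\<close>.\<close>

lemma card_fibre:
  fixes X :: "'a :: {field, finite} vec set"
  assumes X: "X \<subseteq> carrier_vec k" and w: "w \<in> carrier_vec k" and x: "x \<in> carrier_vec k"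
    and wx: "w \<bullet> x \<noteq> 0" and cl: "\<And>v c. v \<in> X \<Longrightarrow> v + c \<cdot>\<^sub>v w \<in> X"
  shows "CARD('a) * card {v \<in> X. v \<bullet> x = a} = card X"
proof -
  have finX: "finite X" using X finite_carrier_vec finite_subset by blast
  have eq: "card {v \<in> X. v \<bullet> x = b} = card {v \<in> X. v \<bullet> x = a}" for b
  proof (rule bij_betw_same_card)
    \<comment> \<open>the translation that carries the fibre over \<open>a\<close> to the fibre over \<open>b\<close>\<close>
    let ?f = "\<lambda>a b v. v + ((b - a) / (w \<bullet> x)) \<cdot>\<^sub>v w"
    have maps: "?f a b v \<in> {v \<in> X. v \<bullet> x = b}" if "v \<in> {v \<in> X. v \<bullet> x = a}" for a b v
    proof -
      have v: "v \<in> carrier_vec k" using that X by auto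
      have "?f a b v \<bullet> x = v \<bullet> x + (b - a) / (w \<bullet> x) * (w \<bullet> x)"
        using v w x by (simp add: add_scalar_prod_distrib)
      then show ?thesis using that cl wx by auto
    qed
    have inv: "?f b a (?f a b v) = v" if "v \<in> {v \<in> X. v \<bullet> x = a}" for a b v
    proof -
      have v: "v \<in> carrier_vec k" using that X by auto
      show ?thesis using v w by (intro eq_vecI) (auto simp: field_simps diff_divide_distrib)
    qed
    show "bij_betw (?f b a) {v \<in> X. v \<bullet> x = b} {v \<in> X. v \<bullet> x = a}"
      by (rule bij_betw_byWitness[where f' = "?f a b"]) (use maps inv in blast)+
  qed
  have "card X = card (\<Union>b\<in>UNIV. {v \<in> X. v \<bullet> x = b})"
    by (rule arg_cong[where f = card]) auto
  also have "\<dots> = (\<Sum>b\<in>UNIV. card {v \<in> X. v \<bullet> x = b})"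
    by (rule card_UN_disjoint) (use finX in auto)
  also have "\<dots> = CARD('a) * card {v \<in> X. v \<bullet> x = a}" by (subst eq) simp
  finally show ?thesis by simp
qed

lemma card_fibre_nonzero:
  fixes X :: "'a :: {field, finite} vec set"
  assumes X: "X \<subseteq> carrier_vec k" and w: "w \<in> carrier_vec k" and x: "x \<in> carrier_vec k"
    and wx: "w \<bullet> x \<noteq> 0" and cl: "\<And>v c. v \<in> X \<Longrightarrow> v + c \<cdot>\<^sub>v w \<in> X"
  shows "CARD('a) * card {v \<in> X. v \<bullet> x \<noteq> 0} = (CARD('a) - 1) * card X"
proof -
  have finX: "finite X" using X finite_carrier_vec finite_subset by blast
  let ?N = "card {v \<in> X. v \<bullet> x \<noteq> 0}" and ?Z = "card {v \<in> X. v \<bullet> x = 0}"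
  have sum: "?N + ?Z = card X"
    by (subst card_Un_disjoint[symmetric]) (use finX in \<open>auto intro!: arg_cong[where f = card]\<close>)
  have "CARD('a) * ?Z = card X"
    by (rule card_fibre) (use assms in auto)
  moreover have "CARD('a) * ?N + CARD('a) * ?Z = CARD('a) * card X"
    by (simp only: sum distrib_left[symmetric])
  ultimately show ?thesis by (simp add: diff_mult_distrib)
qed

lemma ex_nonorthogonal:
  fixes x :: "'a :: field vec"
  assumes "x \<in> carrier_vec k" "x \<noteq> 0\<^sub>v k"
  shows "\<exists>w \<in> carrier_vec k. w \<bullet> x \<noteq> 0"
proof -
  obtain i where "i < k" "x $ i \<noteq> 0" using assms by (metis carrier_vecD eq_vecI index_zero_vec)
  then have "unit_vec k i \<bullet> x \<noteq> 0" using assms by simp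
  then show ?thesis by (intro bexI[of _ "unit_vec k i"]) auto
qed

text \<open>Modulo \<open>y\<close> the vector \<open>x\<close> may be assumed to vanish at a coordinate \<open>i\<close> where \<open>y\<close> does not; it
still has a nonzero coordinate \<open>j\<close>, and correcting \<open>e_j\<close> by a multiple of \<open>e_i\<close> makes it
orthogonal to \<open>y\<close>.\<close>

lemma ex_separating:
  fixes x y :: "'a :: field vec"
  assumes x: "x \<in> carrier_vec k" and y: "y \<in> carrier_vec k" and np: "\<And>c. x \<noteq> c \<cdot>\<^sub>v y"
  shows "\<exists>w \<in> carrier_vec k. w \<bullet> y = 0 \<and> w \<bullet> x \<noteq> 0"
proof (cases "y = 0\<^sub>v k")
  case True
  have "x \<noteq> 0\<^sub>v k" using np[of 0] True by auto
  then show ?thesis using ex_nonorthogonal[OF x] True by auto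
next
  case False
  obtain i where i: "i < k" "y $ i \<noteq> 0" using False y by (metis carrier_vecD eq_vecI index_zero_vec)
  obtain j where j: "j < k" "x $ j \<noteq> (x $ i / y $ i) * y $ j"
  proof (rule ccontr)
    assume "\<not> thesis"
    then have "\<forall>j<k. x $ j = (x $ i / y $ i) * y $ j" using that by blast
    then have "x = (x $ i / y $ i) \<cdot>\<^sub>v y" using x y by (intro eq_vecI) auto
    with np show False by blast
  qed
  \<comment> \<open>the combination of \<open>e_j\<close> and \<open>e_i\<close> that kills \<open>y\<close>\<close>
  let ?w = "unit_vec k j - (y $ j / y $ i) \<cdot>\<^sub>v unit_vec k i"
  have dot: "?w \<bullet> z = z $ j - (y $ j / y $ i) * z $ i" if "z \<in> carrier_vec k" for z
    using that i j by (simp add: minus_scalar_prod_distrib[of _ k])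
  show ?thesis
    by (rule bexI[of _ ?w]) (use dot[OF x] dot[OF y] i j in \<open>auto simp: field_simps\<close>)
qed

lemma card_hyperplane:
  fixes x :: "'a :: {field, finite} vec"
  assumes "x \<in> carrier_vec k" "x \<noteq> 0\<^sub>v k"
  shows "CARD('a) * card {v \<in> carrier_vec k. v \<bullet> x = a} = CARD('a) ^ k"
    and "CARD('a) * card {v \<in> carrier_vec k. v \<bullet> x \<noteq> 0} = (CARD('a) - 1) * CARD('a) ^ k"
  using ex_nonorthogonal[OF assms] assms
    card_fibre[of "carrier_vec k :: 'a vec set" k _ x] card_fibre_nonzero[of "carrier_vec k :: 'a vec set" k _ x]
  by (auto simp: card_carrier_vec)

text \<open>The conditions \<open>P (v \<bullet> y)\<close> and \<open>v \<bullet> x \<noteq> 0\<close> are statistically independent unless \<open>x\<close> is a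
multiple of \<open>y\<close>. The predicate is left open because two cases are needed: \<open>v \<bullet> y \<noteq> 0\<close> for the
bound on multiplicities and \<open>v \<bullet> y = 1\<close> for affine hyperplanes.\<close>

lemma card_two_conditions:
  fixes x y :: "'a :: {field, finite} vec"
  assumes x: "x \<in> carrier_vec k" and y: "y \<in> carrier_vec k" and np: "\<And>c. x \<noteq> c \<cdot>\<^sub>v y"
  shows "CARD('a) * card {v \<in> carrier_vec k. P (v \<bullet> y) \<and> v \<bullet> x \<noteq> 0}
     = (CARD('a) - 1) * card {v \<in> carrier_vec k. P (v \<bullet> y)}"
proof -
  obtain w where w: "w \<in> carrier_vec k" "w \<bullet> y = 0" "w \<bullet> x \<noteq> 0"
    using ex_separating[OF assms] by blast
  let ?X = "{v \<in> carrier_vec k. P (v \<bullet> y)}"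
  have "CARD('a) * card {v \<in> ?X. v \<bullet> x \<noteq> 0} = (CARD('a) - 1) * card ?X"
    by (rule card_fibre_nonzero[OF _ w(1) x w(3)])
      (use w y in \<open>auto simp: add_scalar_prod_distrib\<close>)
  then show ?thesis by (simp add: conj_assoc)
qed

section \<open>Points of projective space\<close>

text \<open>For \<open>v \<noteq> 0\<close> this is the point of projective space spanned by \<open>v\<close>, without the origin. The
zero vector forms a class of its own, so that zero columns are recorded in the same multiset.\<close>

definition projpoint :: "'a :: field vec \<Rightarrow> 'a vec set" where
  "projpoint v = {a \<cdot>\<^sub>v v | a. a \<noteq> 0}"

lemma projpoint_self: "v \<in> projpoint v"
  unfolding projpoint_def by (auto intro!: exI[of _ 1])

lemma projpoint_eq_iff: "projpoint v = projpoint w \<longleftrightarrow> (\<exists>a. a \<noteq> 0 \<and> v = a \<cdot>\<^sub>v w)"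
proof
  show "projpoint v = projpoint w \<Longrightarrow> \<exists>a. a \<noteq> 0 \<and> v = a \<cdot>\<^sub>v w"
    using projpoint_self[of v] unfolding projpoint_def by auto
  assume "\<exists>a. a \<noteq> 0 \<and> v = a \<cdot>\<^sub>v w"
  then obtain a where a: "a \<noteq> 0" "v = a \<cdot>\<^sub>v w" by blast
  show "projpoint v = projpoint w"
  proof (intro equalityI subsetI)
    fix z assume "z \<in> projpoint v"
    then show "z \<in> projpoint w" unfolding projpoint_def using a
      by (auto simp: smult_smult_assoc)
  next
    fix z assume "z \<in> projpoint w"
    then obtain b where b: "b \<noteq> 0" "z = b \<cdot>\<^sub>v w" unfolding projpoint_def by auto
    have "z = (b / a) \<cdot>\<^sub>v v" using a b by (simp add: smult_smult_assoc)
    then show "z \<in> projpoint v" unfolding projpoint_def using a b by (auto intro!: exI[of _ "b / a"])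
  qed
qed

lemma projpoint_mem_iff: "z \<in> projpoint w \<longleftrightarrow> projpoint z = projpoint w"
  unfolding projpoint_eq_iff by (auto simp: projpoint_def)

text \<open>A summand that is constant on projective classes factors through \<open>projpoint\<close>, so the sum
is determined by the multiset of classes. The lemma is applied to weights, and over \<open>F_2\<close> and
\<open>F_3\<close> to Gram forms.\<close>

lemma sum_list_projpoint_cong:
  fixes f :: "'a :: field vec \<Rightarrow> 'b :: comm_monoid_add"
  assumes inv: "\<And>v w. projpoint v = projpoint w \<Longrightarrow> f v = f w"
    and "mset (map projpoint vs) = mset (map projpoint ws)"
  shows "(\<Sum>v\<leftarrow>vs. f v) = (\<Sum>v\<leftarrow>ws. f v)"
proof -
  define g where "g c = f (SOME v. projpoint v = c)" for c
  have g: "f v = g (projpoint v)" for v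
    unfolding g_def by (rule inv[symmetric]) (rule someI_ex, blast)
  have "(\<Sum>v\<leftarrow>us. f v) = sum_mset (image_mset g (mset (map projpoint us)))" for us
    by (simp add: g sum_mset_sum_list[symmetric] image_mset.compositionality o_def flip: mset_map)
  then show ?thesis using assms(2) by metis
qed

lemma dot_eq_0_projpoint:
  assumes "projpoint v = projpoint w" "x \<in> carrier_vec k" "w \<in> carrier_vec k"
  shows "v \<bullet> x = 0 \<longleftrightarrow> w \<bullet> x = 0"
  using assms unfolding projpoint_eq_iff by auto

section \<open>The simplex code\<close>

text \<open>Shifting the summation variable by 1 leaves the sum of all field elements unchanged.\<close>

lemma of_nat_card_field: "of_nat CARD('a) = (0 :: 'a :: {field, finite})"
proof -
  have "(\<Sum>a\<in>UNIV. a) = (\<Sum>a\<in>UNIV. a + 1 :: 'a)"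
    by (rule sum.reindex_bij_witness[of _ "\<lambda>a. a + 1" "\<lambda>a. a - 1"]) auto
  then show ?thesis by (simp add: sum.distrib)
qed

lemma card_field_gt_1: "CARD('a :: {field, finite}) > 1"
  using card_mono[of UNIV "{0, 1 :: 'a}"] by simp

text \<open>One representative of each projective point, that is, a generator matrix of the simplex code. The
choice of representatives affects it only up to equivalence.\<close>

definition simplex_columns :: "nat \<Rightarrow> 'a :: {field, finite} vec list" where
  "simplex_columns k = (SOME vs. set vs \<subseteq> carrier_vec k - {0\<^sub>v k} \<and> distinct (map projpoint vs) \<and>
     projpoint ` set vs = projpoint ` (carrier_vec k - {0\<^sub>v k}))"

lemma simplex_columns:
  shows "set (simplex_columns k :: 'a :: {field, finite} vec list) \<subseteq> carrier_vec k - {0\<^sub>v k}"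
    and "distinct (map projpoint (simplex_columns k :: 'a vec list))"
    and "projpoint ` set (simplex_columns k :: 'a vec list) = projpoint ` (carrier_vec k - {0\<^sub>v k})"
proof -
  let ?V = "carrier_vec k - {0\<^sub>v k} :: 'a vec set"
  have "finite (projpoint ` ?V)" by simp
  then obtain cs where cs: "set cs = projpoint ` ?V" "distinct cs"
    using finite_distinct_list by blast
  define rep where "rep c = (SOME v. v \<in> ?V \<and> projpoint v = c)" for c
  have rep: "rep c \<in> ?V" "projpoint (rep c) = c" if "c \<in> set cs" for c
  proof -
    have "\<exists>v. v \<in> ?V \<and> projpoint v = c" using that cs(1) by auto
    from someI_ex[OF this] show "rep c \<in> ?V" "projpoint (rep c) = c" unfolding rep_def by blast+
  qed
  have m: "map projpoint (map rep cs) = cs" using rep by (simp add: map_idI)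
  have "set (map rep cs) \<subseteq> ?V \<and> distinct (map projpoint (map rep cs)) \<and>
     projpoint ` set (map rep cs) = projpoint ` ?V"
    using rep(1) cs m by (metis (no_types, lifting) image_subset_iff list.set_map)
  from someI[of "\<lambda>vs. set vs \<subseteq> ?V \<and> distinct (map projpoint vs) \<and> projpoint ` set vs = projpoint ` ?V", OF this]
  show "set (simplex_columns k :: 'a vec list) \<subseteq> ?V"
    "distinct (map projpoint (simplex_columns k :: 'a vec list))"
    "projpoint ` set (simplex_columns k :: 'a vec list) = projpoint ` ?V"
    unfolding simplex_columns_def by blast+
qed

lemma card_projpoint:
  fixes v :: "'a :: {field, finite} vec"
  assumes "v \<in> carrier_vec k" "v \<noteq> 0\<^sub>v k"
  shows "card (projpoint v) = CARD('a) - 1"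
proof -
  obtain i where i: "i < dim_vec v" "v $ i \<noteq> 0"
    using assms by (metis carrier_vecD eq_vecI index_zero_vec)
  have "projpoint v = (\<lambda>a. a \<cdot>\<^sub>v v) ` (UNIV - {0})" unfolding projpoint_def by auto
  moreover have "inj_on (\<lambda>a. a \<cdot>\<^sub>v v) (UNIV - {0})"
  proof (rule inj_onI)
    fix a b assume "a \<cdot>\<^sub>v v = b \<cdot>\<^sub>v v"
    then have "(a \<cdot>\<^sub>v v) $ i = (b \<cdot>\<^sub>v v) $ i" by simp
    then show "a = b" using i by simp
  qed
  ultimately show ?thesis by (simp add: card_image card_Diff_singleton)
qed

lemma smult_eq_zero_iff:
  fixes v :: "'a :: field vec"
  assumes "v \<in> carrier_vec k" "a \<noteq> 0"
  shows "a \<cdot>\<^sub>v v = 0\<^sub>v k \<longleftrightarrow> v = 0\<^sub>v k"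
  using assms by (auto simp: vec_eq_iff)

text \<open>The nonzero vectors split into projective points of \<open>q - 1\<close> elements each. This turns counts over
the whole space into counts over the columns of the simplex code.\<close>

lemma sum_nonzero_vectors:
  fixes f :: "'a :: {field, finite} vec \<Rightarrow> nat"
  assumes inv: "\<And>v w. projpoint v = projpoint w \<Longrightarrow> f v = f w"
  shows "(\<Sum>v \<in> carrier_vec k - {0\<^sub>v k}. f v) = (CARD('a) - 1) * (\<Sum>v\<leftarrow>simplex_columns k. f v)"
proof -
  let ?S = "simplex_columns k :: 'a vec list"
  note S = simplex_columns[where 'a = 'a and k = k]
  have "carrier_vec k - {0\<^sub>v k} = (\<Union>v\<in>set ?S. projpoint v)"
  proof (intro equalityI subsetI)
    fix v :: "'a vec" assume "v \<in> carrier_vec k - {0\<^sub>v k}"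
    then have "projpoint v \<in> projpoint ` set ?S" using S(3) by blast
    then show "v \<in> (\<Union>v\<in>set ?S. projpoint v)" using projpoint_self[of v] by auto
  next
    fix v :: "'a vec" assume "v \<in> (\<Union>v\<in>set ?S. projpoint v)"
    then obtain u a where u: "u \<in> set ?S" "a \<noteq> 0" "v = a \<cdot>\<^sub>v u"
      unfolding projpoint_def by blast
    then have "u \<in> carrier_vec k" "u \<noteq> 0\<^sub>v k" using S(1) by blast+
    then show "v \<in> carrier_vec k - {0\<^sub>v k}" using u smult_eq_zero_iff[of u k a] by simp
  qed
  then have "(\<Sum>v \<in> carrier_vec k - {0\<^sub>v k}. f v) = (\<Sum>v \<in> (\<Union>v\<in>set ?S. projpoint v). f v)"
    by simp
  also have "\<dots> = (\<Sum>v\<in>set ?S. \<Sum>w\<in>projpoint v. f w)"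
  proof (rule sum.UNION_disjoint)
    show "\<forall>v\<in>set ?S. finite (projpoint v)"
      unfolding projpoint_def by simp
    show "\<forall>v\<in>set ?S. \<forall>w\<in>set ?S. v \<noteq> w \<longrightarrow> projpoint v \<inter> projpoint w = {}"
    proof (intro ballI impI)
      fix v w assume vw: "v \<in> set ?S" "w \<in> set ?S" "v \<noteq> w"
      then have "projpoint v \<noteq> projpoint w" using S(2) unfolding distinct_map inj_on_def by blast
      then show "projpoint v \<inter> projpoint w = {}"
        using projpoint_mem_iff by (metis disjoint_iff)
    qed
  qed simp
  also have "\<dots> = (\<Sum>v\<in>set ?S. (CARD('a) - 1) * f v)"
  proof (rule sum.cong[OF refl])
    fix v assume "v \<in> set ?S"
    then have "card (projpoint v) = CARD('a) - 1" using S(1) card_projpoint by blast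
    moreover have "(\<Sum>w\<in>projpoint v. f w) = (\<Sum>w\<in>projpoint v. f v)"
      by (rule sum.cong) (use inv projpoint_mem_iff in blast)+
    ultimately show "(\<Sum>w\<in>projpoint v. f w) = (CARD('a) - 1) * f v" by simp
  qed
  also have "\<dots> = (CARD('a) - 1) * (\<Sum>v\<leftarrow>?S. f v)"
    using S(2) by (simp add: sum_distrib_left distinct_map sum_list_distinct_conv_sum_set)
  finally show ?thesis .
qed

lemma length_simplex_columns:
  "length (simplex_columns k :: 'a :: {field, finite} vec list) = q_bracket CARD('a) k"
  and q_bracket_mult: "(CARD('a) - 1) * q_bracket CARD('a) k = CARD('a) ^ k - 1"
proof -
  have *: "(CARD('a) - 1) * length (simplex_columns k :: 'a vec list) = CARD('a) ^ k - 1"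
    using sum_nonzero_vectors[of "\<lambda>_ :: 'a vec. 1" k]
    by (simp add: sum_list_triv card_Diff_singleton card_carrier_vec)
  then show len: "length (simplex_columns k :: 'a vec list) = q_bracket CARD('a) k"
    unfolding q_bracket_def using card_field_gt_1[where 'a = 'a]
    by (metis nonzero_mult_div_cancel_left not_less_eq numeral_nat(7) zero_less_diff less_numeral_extra(3))
  show "(CARD('a) - 1) * q_bracket CARD('a) k = CARD('a) ^ k - 1" using * unfolding len .
qed

lemma weight_simplex_columns:
  fixes x :: "'a :: {field, finite} vec"
  assumes x: "x \<in> carrier_vec k" "x \<noteq> 0\<^sub>v k"
  shows "weight (simplex_columns k) x = CARD('a) ^ (k - 1)"
proof -
  have k: "k \<noteq> 0" using x by (intro notI) auto
  let ?S = "simplex_columns k :: 'a vec list"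
  \<comment> \<open>outside \<open>carrier_vec k\<close> the scalar product need not respect scaling, so the summand is set to 0 there\<close>
  let ?f = "\<lambda>v. if v \<in> carrier_vec k then of_bool (v \<bullet> x \<noteq> 0) else 0 :: nat"
  have inv: "?f v = ?f w" if "projpoint v = projpoint w" for v w
    using that x unfolding projpoint_eq_iff by auto
  have "card {v \<in> carrier_vec k. v \<bullet> x \<noteq> 0} = (\<Sum>v \<in> carrier_vec k. of_bool (v \<bullet> x \<noteq> 0))"
    by (simp add: of_bool_def sum.If_cases Int_def)
  also have "\<dots> = (\<Sum>v \<in> carrier_vec k - {0\<^sub>v k}. ?f v)"
    by (rule sum.mono_neutral_cong_right) (use x in auto)
  also have "\<dots> = (CARD('a) - 1) * (\<Sum>v\<leftarrow>?S. ?f v)"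
    by (rule sum_nonzero_vectors) (use inv in blast)
  also have "(\<Sum>v\<leftarrow>?S. ?f v) = weight ?S x" unfolding weight_def
    by (rule arg_cong[where f = sum_list], rule map_cong) (use simplex_columns(1)[of k] in auto)
  finally have "CARD('a) * ((CARD('a) - 1) * weight ?S x) = (CARD('a) - 1) * CARD('a) ^ k"
    using card_hyperplane(2)[OF x] by simp
  then have "(CARD('a) - 1) * (CARD('a) * weight ?S x) = (CARD('a) - 1) * CARD('a) ^ k"
    by (simp add: mult.left_commute)
  then have "CARD('a) * weight ?S x = CARD('a) ^ k" using card_field_gt_1[where 'a = 'a] by simp
  also have "\<dots> = CARD('a) * CARD('a) ^ (k - 1)" using k by (simp flip: power_Suc)
  finally show ?thesis by simp
qed

lemma weight_append [simp]: "weight (vs @ ws) x = weight vs x + weight ws x"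
  by (simp add: weight_def)

lemma gram_append [simp]: "gram (vs @ ws) x y = gram vs x y + gram ws x y"
  by (simp add: gram_def)

lemma weight_copies [simp]: "weight (concat (replicate u vs)) x = u * weight vs x"
  by (induction u) (simp_all add: weight_def)

lemma gram_copies [simp]: "gram (concat (replicate u vs)) x y = of_nat u * gram vs x y"
  by (induction u) (simp_all add: gram_def algebra_simps)

lemma length_copies [simp]: "length (concat (replicate u vs)) = u * length vs"
  by (induction u) simp_all

lemma weight_zero [simp]: "set vs \<subseteq> carrier_vec k \<Longrightarrow> weight vs (0\<^sub>v k) = 0"
  unfolding weight_def by (induction vs) auto

lemma square_eq_one:
  assumes "CARD('a :: {field, finite}) \<in> {2, 3}" and a: "(a :: 'a) \<noteq> 0"
  shows "a * a = 1"
proof (cases "CARD('a) = 2")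
  case True
  have "{0, 1 :: 'a} = UNIV" by (rule card_subset_eq) (auto simp: True)
  then show ?thesis using a by auto
next
  case False
  then have c: "CARD('a) = 3" using assms by auto
  have three: "(3 :: 'a) = 0" using of_nat_card_field[where 'a = 'a] c by simp
  have "(1 :: 'a) \<noteq> - 1"
  proof
    assume "(1 :: 'a) = - 1"
    then have "(1 :: 'a) + 1 = 0" by (metis add.right_inverse)
    then have "(3 :: 'a) = 1" by (metis add_0 numeral_Bit1 numeral_One)
    with three show False by simp
  qed
  then have "{0, 1, - 1 :: 'a} = UNIV" by (intro card_subset_eq) (auto simp: c)
  then show ?thesis using a by auto
qed

text \<open>For \<open>q = 2\<close> and \<open>q = 3\<close> each nonzero \<open>v \<bullet> x\<close> contributes 1 to the sum of squares.\<close>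

lemma gram_self:
  assumes "CARD('a :: {field, finite}) \<in> {2, 3}"
  shows "gram vs x x = (of_nat (weight vs x) :: 'a)"
  unfolding gram_def weight_def using square_eq_one[OF assms] by (induction vs) auto

text \<open>The simplex code is self-orthogonal because its weights are highly divisible. For \<open>q = 2\<close> the
supports of two codewords meet in half of \<open>wt x + wt y - wt (x + y)\<close> positions, which is even
since \<open>4\<close> divides \<open>2^(k-1)\<close>. For \<open>q = 3\<close> the quadratic form \<open>gram x x = wt x\<close> vanishes modulo 3,
hence so does its polarization, as 2 is invertible.\<close>

lemma gram_simplex_columns:
  fixes x y :: "'a :: {field, finite} vec"
  assumes q: "CARD('a) = 2 \<and> k \<ge> 3 \<or> CARD('a) = 3 \<and> k \<ge> 2"
    and x: "x \<in> carrier_vec k" and y: "y \<in> carrier_vec k"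
  shows "gram (simplex_columns k) x y = 0"
proof -
  let ?S = "simplex_columns k :: 'a vec list"
  have S: "set ?S \<subseteq> carrier_vec k" using simplex_columns(1)[of k] by blast
  have dvd: "CARD('a) ^ (k - 1) dvd weight ?S z" if "z \<in> carrier_vec k" for z
    using weight_simplex_columns[OF that] S by (cases "z = 0\<^sub>v k") auto
  have xy: "x + y \<in> carrier_vec k" using x y by simp
  have dot: "v \<bullet> (x + y) = v \<bullet> x + v \<bullet> y" if "v \<in> set ?S" for v
    using that S x y by (intro scalar_prod_add_distrib[of _ k]) auto
  show ?thesis
  proof (cases "CARD('a) = 2")
    case True
    have U: "{0, 1 :: 'a} = UNIV" by (rule card_subset_eq) (auto simp: True)
    have two: "(2 :: 'a) = 0" using of_nat_card_field[where 'a = 'a] True by simp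
    let ?o = "\<Sum>v\<leftarrow>?S. of_bool (v \<bullet> x \<noteq> 0 \<and> v \<bullet> y \<noteq> 0) :: nat"
    \<comment> \<open>inclusion and exclusion at a single column, using that \<open>a + b = 0\<close> for \<open>a = b = 1\<close>\<close>
    have bit: "of_bool (a \<noteq> 0) + of_bool (b \<noteq> 0)
      = of_bool (a + b \<noteq> 0) + 2 * (of_bool (a \<noteq> 0 \<and> b \<noteq> 0) :: nat)"
      "a * b = of_nat (of_bool (a \<noteq> 0 \<and> b \<noteq> 0))" for a b :: 'a
    proof -
      have "a \<in> {0, 1}" "b \<in> {0, 1}" using U by auto
      then show "of_bool (a \<noteq> 0) + of_bool (b \<noteq> 0)
        = of_bool (a + b \<noteq> 0) + 2 * (of_bool (a \<noteq> 0 \<and> b \<noteq> 0) :: nat)"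
        "a * b = of_nat (of_bool (a \<noteq> 0 \<and> b \<noteq> 0))" using two by auto
    qed
    have "weight ?S x + weight ?S y = (\<Sum>v\<leftarrow>?S. of_bool (v \<bullet> x + v \<bullet> y \<noteq> 0)) + 2 * ?o"
      unfolding weight_def sum_list_addf[symmetric] sum_list_const_mult[symmetric]
      by (simp only: bit(1))
    also have "(\<Sum>v\<leftarrow>?S. of_bool (v \<bullet> x + v \<bullet> y \<noteq> 0)) = weight ?S (x + y)"
      unfolding weight_def by (rule arg_cong[where f = sum_list], rule map_cong) (use dot in auto)
    finally have *: "weight ?S x + weight ?S y = weight ?S (x + y) + 2 * ?o" .
    have "(2::nat) ^ 2 dvd 2 ^ (k - 1)" by (rule le_imp_power_dvd) (use q True in auto)
    then have four: "4 dvd weight ?S z" if "z \<in> carrier_vec k" for z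
      using dvd[OF that] True by (auto intro: dvd_trans)
    have "4 dvd weight ?S (x + y) + 2 * ?o"
      unfolding *[symmetric] using four[OF x] four[OF y] by (rule dvd_add)
    then have "4 dvd 2 * ?o" unfolding dvd_add_right_iff[OF four[OF xy]] .
    then obtain m where "2 * ?o = 4 * m" by (rule dvdE)
    then have m: "?o = CARD('a) * m" unfolding True by linarith
    have "gram ?S x y = of_nat ?o"
      unfolding gram_def by (simp add: bit(2) o_def flip: sum_list_of_nat)
    also have "\<dots> = 0" unfolding m of_nat_mult of_nat_card_field by simp
    finally show ?thesis .
  next
    case False
    then have c: "CARD('a) = 3" "k \<ge> 2" using q by auto
    have three: "(3 :: 'a) = 0" using of_nat_card_field[where 'a = 'a] c by simp
    have two: "(2 :: 'a) \<noteq> 0"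
    proof
      assume "(2 :: 'a) = 0"
      then have "(3 :: 'a) = 1" by (metis add_0 numeral_Bit1 numeral_One one_add_one)
      with three show False by simp
    qed
    have self: "gram ?S z z = 0" if z: "z \<in> carrier_vec k" for z
    proof -
      have three_dvd: "(3::nat) ^ 1 dvd 3 ^ (k - 1)" by (rule le_imp_power_dvd) (use c in auto)
      then obtain m where "weight ?S z = CARD('a) * m"
        using dvd_trans[OF three_dvd dvd[OF z, unfolded c(1)]] c(1) by (auto elim: dvdE)
      then have "of_nat (weight ?S z) = (0 :: 'a)" by (simp only: of_nat_mult of_nat_card_field mult_zero_left)
      then show ?thesis using gram_self[where 'a = 'a] c by simp
    qed
    have "gram ?S (x + y) (x + y) = (\<Sum>v\<leftarrow>?S. (v \<bullet> x + v \<bullet> y) * (v \<bullet> x + v \<bullet> y))"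
      unfolding gram_def by (rule arg_cong[where f = sum_list], rule map_cong) (use dot in auto)
    also have "\<dots> = gram ?S x x + 2 * gram ?S x y + gram ?S y y"
      unfolding gram_def sum_list_addf[symmetric] sum_list_const_mult[symmetric]
      by (rule arg_cong[where f = sum_list], rule map_cong) (auto simp: algebra_simps)
    finally show ?thesis using self[OF x] self[OF y] self[OF xy] two by simp
  qed
qed

section \<open>Codes and their column lists\<close>

lemma encode_carrier [simp]: "encode vs x \<in> carrier_vec (length vs)"
  by (simp add: encode_def)

lemma code_subset: "code k vs \<subseteq> carrier_vec (length vs)"
  by (auto simp: code_def)

lemma encode_add:
  assumes "set vs \<subseteq> carrier_vec k" "x \<in> carrier_vec k" "y \<in> carrier_vec k"
  shows "encode vs (x + y) = encode vs x + encode vs y"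
proof (rule eq_vecI)
  fix i assume "i < dim_vec (encode vs x + encode vs y)"
  then have i: "i < length vs" by (simp add: encode_def)
  then have "vs ! i \<in> carrier_vec k" using assms(1) nth_mem by blast
  then show "encode vs (x + y) $ i = (encode vs x + encode vs y) $ i"
    using i assms by (simp add: encode_def scalar_prod_add_distrib[of _ k])
qed (simp add: encode_def)

lemma encode_smult:
  assumes "set vs \<subseteq> carrier_vec k" "x \<in> carrier_vec k"
  shows "encode vs (a \<cdot>\<^sub>v x) = a \<cdot>\<^sub>v encode vs x"
proof (rule eq_vecI)
  fix i assume "i < dim_vec (a \<cdot>\<^sub>v encode vs x)"
  then have i: "i < length vs" by (simp add: encode_def)
  then have "vs ! i \<in> carrier_vec k" using assms(1) nth_mem by blast
  then show "encode vs (a \<cdot>\<^sub>v x) $ i = (a \<cdot>\<^sub>v encode vs x) $ i"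
    using i assms by (simp add: encode_def)
qed (simp add: encode_def)

lemma encode_zero:
  assumes "set vs \<subseteq> carrier_vec k"
  shows "encode vs (0\<^sub>v k) = 0\<^sub>v (length vs)"
  using assms nth_mem by (intro eq_vecI) (fastforce simp: encode_def)+

lemma encode_dot:
  shows "encode vs x \<bullet> encode vs y = gram vs x y"
  by (simp add: scalar_prod_def encode_def gram_def sum_list_sum_nth)

lemma hamming_weight_encode: "hamming_weight (encode vs x) = weight vs x"
proof -
  have "weight vs x = (\<Sum>i<length vs. of_bool (vs ! i \<bullet> x \<noteq> 0))"
    by (simp add: weight_def sum_list_sum_nth atLeast0LessThan)
  also have "\<dots> = card {i. i < length vs \<and> vs ! i \<bullet> x \<noteq> 0}"
    by (simp add: of_bool_def sum.If_cases Int_def)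
  also have "{i. i < length vs \<and> vs ! i \<bullet> x \<noteq> 0}
      = {i. i < dim_vec (encode vs x) \<and> encode vs x $ i \<noteq> 0}"
    by (auto simp: encode_def)
  finally show ?thesis unfolding hamming_weight_def by simp
qed

text \<open>A message with codeword 0 lies in the radical of the Gram form.\<close>

lemma nondegenerate_inj:
  assumes vs: "set vs \<subseteq> carrier_vec k" and nd: "nondegenerate k vs"
  shows "inj_on (encode vs) (carrier_vec k)"
proof (rule inj_onI)
  fix x y assume xy: "x \<in> carrier_vec k" "y \<in> carrier_vec k" "encode vs x = encode vs y"
  let ?z = "x + (- 1) \<cdot>\<^sub>v y"
  have z: "?z \<in> carrier_vec k" using xy by simp
  have "encode vs ?z = encode vs y + (- 1) \<cdot>\<^sub>v encode vs y"
    using xy vs by (simp add: encode_add encode_smult)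
  also have "\<dots> = 0\<^sub>v (length vs)" by (rule eq_vecI) (simp_all add: encode_def)
  finally have "\<forall>w\<in>carrier_vec k. gram vs ?z w = 0"
    by (simp flip: encode_dot)
  then have "?z = 0\<^sub>v k" using nd z unfolding nondegenerate_def by blast
  show "x = y"
  proof (rule eq_vecI)
    fix i assume i: "i < dim_vec y"
    have "?z $ i = 0" using \<open>?z = 0\<^sub>v k\<close> i xy by simp
    then show "x $ i = y $ i" using i xy by simp
  qed (use xy in simp)
qed

text \<open>The Gram form is the standard inner product pulled back along the encoding, so its radical
consists of the messages whose codewords are orthogonal to the code.\<close>

lemma LCD_code_iff:
  assumes vs: "set vs \<subseteq> carrier_vec k" and n: "length vs = n"
  shows "nondegenerate k vs \<longleftrightarrow> inj_on (encode vs) (carrier_vec k) \<and> LCD n (code k vs)"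
proof -
  have dual: "encode vs x \<in> dual_code n (code k vs) \<longleftrightarrow> (\<forall>y\<in>carrier_vec k. gram vs x y = 0)" for x
    unfolding dual_code_def vec_module.orthogonal_complement_def code_def using n
    by (auto simp: encode_dot)
  have zero: "encode vs (0\<^sub>v k) = 0\<^sub>v n" using encode_zero[OF vs] n by simp
  have zdual: "0\<^sub>v n \<in> code k vs \<inter> dual_code n (code k vs)"
  proof -
    have "encode vs (0\<^sub>v k) \<in> code k vs" unfolding code_def by (rule imageI) simp
    then have "0\<^sub>v n \<in> code k vs" unfolding zero .
    moreover have "0\<^sub>v n \<in> dual_code n (code k vs)"
      unfolding dual_code_def vec_module.orthogonal_complement_def
      by (intro CollectI conjI ballI zero_carrier_vec scalar_prod_left_zero)
        (use code_subset[of k vs] n in blast)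
    ultimately show ?thesis by blast
  qed
  show ?thesis
  proof
    assume nd: "nondegenerate k vs"
    have "c = 0\<^sub>v n" if c: "c \<in> code k vs \<inter> dual_code n (code k vs)" for c
    proof -
      obtain x where "x \<in> carrier_vec k" "c = encode vs x" using c unfolding code_def by blast
      moreover from this have "\<forall>y\<in>carrier_vec k. gram vs x y = 0" using c dual by blast
      ultimately show ?thesis using nd zero unfolding nondegenerate_def by metis
    qed
    then have "LCD n (code k vs)" using zdual unfolding LCD_def by blast
    then show "inj_on (encode vs) (carrier_vec k) \<and> LCD n (code k vs)"
      using nondegenerate_inj[OF vs nd] by blast
  next
    assume A: "inj_on (encode vs) (carrier_vec k) \<and> LCD n (code k vs)"
    show "nondegenerate k vs"
      unfolding nondegenerate_def
    proof (intro ballI impI)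
      fix x assume x: "x \<in> carrier_vec k" "\<forall>y\<in>carrier_vec k. gram vs x y = 0"
      then have "encode vs x \<in> code k vs \<inter> dual_code n (code k vs)"
        using dual unfolding code_def by blast
      then have "encode vs x = encode vs (0\<^sub>v k)" using A unfolding LCD_def zero by blast
      then show "x = 0\<^sub>v k" using A x(1) by (meson inj_onD zero_carrier_vec)
    qed
  qed
qed

text \<open>A dual word of weight 1 supported at \<open>i\<close> exists exactly if all codewords vanish at \<open>i\<close>, that is,
if the column at \<open>i\<close> is orthogonal to all messages.\<close>

lemma dual_distance_code_iff:
  fixes vs :: "'a :: field vec list"
  assumes vs: "set vs \<subseteq> carrier_vec k" and n: "length vs = n"
  shows "2 \<le> dual_distance n (code k vs) \<longleftrightarrow> 0\<^sub>v k \<notin> set vs"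
proof -
  let ?D = "dual_code n (code k vs)"
  have D: "c \<in> ?D \<longleftrightarrow> c \<in> carrier_vec n \<and> (\<forall>x\<in>carrier_vec k. c \<bullet> encode vs x = 0)" for c
    unfolding dual_code_def vec_module.orthogonal_complement_def code_def by auto
  have le: "2 \<le> dual_distance n (code k vs) \<longleftrightarrow>
      (\<forall>c\<in>?D. c \<noteq> 0\<^sub>v (dim_vec c) \<longrightarrow> 2 \<le> hamming_weight c)"
    unfolding dual_distance_def min_weight_def le_INF_iff
    by (auto simp: numeral_eq_enat)
  show ?thesis
  proof
    assume L: "2 \<le> dual_distance n (code k vs)"
    show "0\<^sub>v k \<notin> set vs"
    proof
      assume "0\<^sub>v k \<in> set vs"
      then obtain i where i: "i < n" "vs ! i = 0\<^sub>v k" using n by (metis in_set_conv_nth)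
      have "encode vs x $ i = 0" if "x \<in> carrier_vec k" for x
        using i n that by (simp add: encode_def)
      then have "unit_vec n i \<in> ?D" unfolding D
        using i n by (auto simp: scalar_prod_left_unit[OF encode_carrier[of vs, unfolded n] i(1)])
      moreover have "unit_vec n i \<noteq> 0\<^sub>v (dim_vec (unit_vec n i))" using i by simp
      ultimately have "2 \<le> hamming_weight (unit_vec n i :: 'a vec)" using L le by blast
      moreover have "{j. j < n \<and> unit_vec n i $ j \<noteq> (0 :: 'a)} = {i}" using i by (auto split: if_splits)
      ultimately show False by (simp add: hamming_weight_def)
    qed
  next
    assume nz: "0\<^sub>v k \<notin> set vs"
    show "2 \<le> dual_distance n (code k vs)" unfolding le
    proof (intro ballI impI)
      fix c assume c: "c \<in> ?D" "c \<noteq> 0\<^sub>v (dim_vec c)"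
      have dc: "dim_vec c = n" using c(1) unfolding D by simp
      obtain i where i: "i < n" "c $ i \<noteq> 0" using c(2) dc by (metis eq_vecI index_zero_vec)
      have vi: "vs ! i \<in> carrier_vec k" "vs ! i \<noteq> 0\<^sub>v k" using i n vs nz nth_mem by (blast, metis)
      obtain x where x: "x \<in> carrier_vec k" "x \<bullet> vs ! i \<noteq> 0" using ex_nonorthogonal[OF vi] by blast
      have xi: "vs ! i \<bullet> x \<noteq> 0" using x comm_scalar_prod[OF x(1) vi(1)] by simp
      have "\<exists>j<n. j \<noteq> i \<and> c $ j \<noteq> 0"
      proof (rule ccontr)
        assume "\<not> ?thesis"
        then have z: "c $ j = 0" if "j < n" "j \<noteq> i" for j using that by blast
        have "c \<bullet> encode vs x = (\<Sum>j\<in>{0..<n}. c $ j * (vs ! j \<bullet> x))"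
          using n by (simp add: scalar_prod_def encode_def)
        also have "\<dots> = (\<Sum>j\<in>{i}. c $ j * (vs ! j \<bullet> x))"
          by (rule sum.mono_neutral_right) (use i z in auto)
        finally have "c \<bullet> encode vs x \<noteq> 0" using i xi by simp
        then show False using c(1) x(1) unfolding D by blast
      qed
      then obtain j where j: "j < n" "j \<noteq> i" "c $ j \<noteq> 0" by blast
      have "card {i, j} \<le> card {i. i < dim_vec c \<and> c $ i \<noteq> 0}"
        by (rule card_mono) (use i j dc in auto)
      then show "2 \<le> hamming_weight c" using j(2) unfolding hamming_weight_def by simp
    qed
  qed
qed

text \<open>The infimum is attained because \<open>enat\<close> is well-ordered; it is infinite exactly when there is no
nonzero codeword.\<close>

lemma min_weight_eq_iff:
  "min_weight C = enat d \<longleftrightarrow>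
     (\<forall>c\<in>C. c \<noteq> 0\<^sub>v (dim_vec c) \<longrightarrow> d \<le> hamming_weight c) \<and>
     (\<exists>c\<in>C. c \<noteq> 0\<^sub>v (dim_vec c) \<and> hamming_weight c = d)"
proof -
  let ?N = "{c \<in> C. c \<noteq> 0\<^sub>v (dim_vec c)}" and ?w = "\<lambda>c. enat (hamming_weight c)"
  show ?thesis
  proof
    assume m: "min_weight C = enat d"
    have "?N \<noteq> {}"
    proof
      assume "?N = {}"
      then have "min_weight C = \<infinity>" unfolding min_weight_def by (simp only: image_empty Inf_enat_def) simp
      with m show False by simp
    qed
    then have "min_weight C \<in> ?w ` ?N"
      unfolding min_weight_def by (metis (no_types, lifting) ex_in_conv imageI wellorder_InfI)
    then have "\<exists>c\<in>?N. hamming_weight c = d" unfolding m by auto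
    moreover have "\<forall>c\<in>?N. min_weight C \<le> ?w c" unfolding min_weight_def by (auto intro: INF_lower)
    ultimately show "(\<forall>c\<in>C. c \<noteq> 0\<^sub>v (dim_vec c) \<longrightarrow> d \<le> hamming_weight c) \<and>
     (\<exists>c\<in>C. c \<noteq> 0\<^sub>v (dim_vec c) \<and> hamming_weight c = d)" unfolding m by auto
  next
    assume R: "(\<forall>c\<in>C. c \<noteq> 0\<^sub>v (dim_vec c) \<longrightarrow> d \<le> hamming_weight c) \<and>
     (\<exists>c\<in>C. c \<noteq> 0\<^sub>v (dim_vec c) \<and> hamming_weight c = d)"
    then obtain c where "c \<in> ?N" "hamming_weight c = d" by blast
    then have "min_weight C \<le> enat d" unfolding min_weight_def by (metis (mono_tags, lifting) INF_lower)
    moreover have "enat d \<le> min_weight C" unfolding min_weight_def using R by (auto intro!: INF_greatest)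
    ultimately show "min_weight C = enat d" by (rule antisym)
  qed
qed

lemma min_weight_code_iff:
  assumes vs: "set vs \<subseteq> carrier_vec k" and inj: "inj_on (encode vs) (carrier_vec k)"
  shows "min_weight (code k vs) = enat d \<longleftrightarrow>
     (\<forall>x\<in>carrier_vec k - {0\<^sub>v k}. d \<le> weight vs x) \<and> (\<exists>x\<in>carrier_vec k - {0\<^sub>v k}. weight vs x = d)"
proof -
  have "encode vs x = 0\<^sub>v (length vs) \<longleftrightarrow> x = 0\<^sub>v k" if "x \<in> carrier_vec k" for x
    using inj that encode_zero[OF vs] by (metis inj_onD zero_carrier_vec)
  then have nz: "encode vs x \<noteq> 0\<^sub>v (dim_vec (encode vs x)) \<longleftrightarrow> x \<noteq> 0\<^sub>v k" if "x \<in> carrier_vec k" for x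
    using that by (simp add: encode_def)
  show ?thesis unfolding min_weight_eq_iff code_def
    by (simp only: ball_simps bex_simps hamming_weight_encode) (use nz in blast)
qed

text \<open>The columns wanted here are the rows of the \<open>n \<times> k\<close> matrix whose columns are a basis of the code.\<close>

lemma linear_code_columns:
  fixes C :: "'a :: {field, finite} vec set"
  assumes "linear_code n k C"
  obtains vs where "length vs = n" "set vs \<subseteq> carrier_vec k" "inj_on (encode vs) (carrier_vec k)"
    "C = code k vs"
proof -
  interpret vec_space "TYPE('a)" n .
  have sub: "VectorSpace.subspace class_ring C V" and dim: "vectorspace.dim class_ring (V\<lparr>carrier := C\<rparr>) = k"
    using assms unfolding linear_code_def by auto
  have submod: "submodule class_ring C V" using sub by (rule is_module)
  have CV: "C \<subseteq> carrier_vec n" using submodule.subset[OF submod] by simp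
  interpret W: vectorspace class_ring "V\<lparr>carrier := C\<rparr>" by (rule subspace_is_vs[OF sub])
  have finC: "finite C" using CV finite_carrier_vec finite_subset by blast
  have "W.span C = C"
    using W.in_own_span[of C] W.span_is_subset2[of C] by auto
  then have "W.fin_dim" unfolding W.fin_dim_def using finC by auto
  then obtain B where B: "finite B" "W.basis B" using W.finite_basis_exists by blast
  have BC: "B \<subseteq> C" using B(2) unfolding W.basis_def by simp
  have cardB: "card B = k" using W.dim_basis[OF B] dim by simp
  have spanB: "span B = C" and liB: "lin_indpt B"
    using B(2) span_li_not_depend[OF BC submod] unfolding W.basis_def by auto
  obtain bs where bs: "set bs = B" "distinct bs" using finite_distinct_list[OF B(1)] by blast
  have len: "length bs = k" using bs cardB distinct_card by metis
  have bsV: "set bs \<subseteq> carrier_vec n" using bs BC CV by blast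
  define A where "A = mat_of_cols n bs"
  have A: "A \<in> carrier_mat n k" unfolding A_def using len by auto
  have mult: "lincomb_list c bs = A *\<^sub>v vec k c" for c
    unfolding A_def len[symmetric] by (rule lincomb_list_as_mat_mult) (use bsV in auto)
  have enc: "encode (rows A) x = A *\<^sub>v x" for x
    using A by (intro eq_vecI) (auto simp: encode_def)
  have "C = code k (rows A)"
  proof -
    have "C = {lincomb_list c bs | c. True}"
      using span_list_as_span[OF bsV] spanB bs unfolding span_list_def by auto
    also have "\<dots> = (\<lambda>x. A *\<^sub>v x) ` carrier_vec k"
    proof (intro equalityI subsetI)
      fix x assume "x \<in> {lincomb_list c bs | c. True}"
      then obtain c where "x = A *\<^sub>v vec k c" unfolding mult by blast
      then show "x \<in> (\<lambda>x. A *\<^sub>v x) ` carrier_vec k" by simp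
    next
      fix x assume "x \<in> (\<lambda>x. A *\<^sub>v x) ` carrier_vec k"
      then obtain y where y: "y \<in> carrier_vec k" "x = A *\<^sub>v y" by blast
      have "vec k (\<lambda>i. y $ i) = y" using y by auto
      then have "x = lincomb_list (\<lambda>i. y $ i) bs" unfolding mult y(2) by simp
      then show "x \<in> {lincomb_list c bs | c. True}" by blast
    qed
    finally show ?thesis unfolding code_def enc .
  qed
  moreover have "inj_on (encode (rows A)) (carrier_vec k)"
  proof (rule inj_onI, unfold enc)
    fix x y assume xy: "x \<in> carrier_vec k" "y \<in> carrier_vec k" "A *\<^sub>v x = A *\<^sub>v y"
    let ?z = "x - y"
    define f where "f v = ?z $ (inv_into {..<k} ((!) bs) v)" for v
    have f: "f (bs ! i) = ?z $ i" if "i < k" for i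
      unfolding f_def using bs(2) len that
      by (subst inv_into_f_f) (auto simp: inj_on_def nth_eq_iff_index_eq)
    have "lincomb f B = lincomb_list (\<lambda>i. f (bs ! i)) bs"
      using lincomb_as_lincomb_list_distinct[OF bsV bs(2)] bs(1) by simp
    also have "\<dots> = A *\<^sub>v vec k (\<lambda>i. f (bs ! i))" by (rule mult)
    also have "vec k (\<lambda>i. f (bs ! i)) = ?z" using f xy by (intro eq_vecI) auto
    also have "A *\<^sub>v ?z = A *\<^sub>v x - A *\<^sub>v y" using A xy by (simp add: mult_minus_distrib_mat_vec)
    also have "\<dots> = 0\<^sub>v n" unfolding xy(3) using A xy by simp
    finally have "lincomb f B = 0\<^sub>v n" .
    then have zero: "f v = 0" if "v \<in> B" for v
      using lin_dep_crit[where A = B and S = B and a = f and v = v] liB B(1) that by auto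
    show "x = y"
    proof (rule eq_vecI)
      fix i assume "i < dim_vec y"
      then have i: "i < k" using xy by simp
      then have "bs ! i \<in> B" using bs len nth_mem by blast
      then have "?z $ i = 0" using zero f[OF i] by simp
      then show "x $ i = y $ i" using i xy by simp
    qed (use xy in simp)
  qed
  moreover have "set (rows A) \<subseteq> carrier_vec k" "length (rows A) = n"
    using A by (auto simp: rows_def)
  ultimately show thesis using that by blast
qed

text \<open>The dimension is recovered from the number of codewords: any basis encodes \<open>q^d\<close> messages
bijectively, so \<open>q^d = q^k\<close>.\<close>

lemma linear_code_code:
  fixes vs :: "'a :: {field, finite} vec list"
  assumes vs: "set vs \<subseteq> carrier_vec k" and inj: "inj_on (encode vs) (carrier_vec k)"
    and n: "length vs = n"
  shows "linear_code n k (code k vs)"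
proof -
  interpret vec_space "TYPE('a)" n .
  let ?C = "code k vs"
  have "VectorSpace.subspace class_ring ?C V"
  proof (intro VectorSpace.subspace.intro submodule.intro)
    show "vectorspace class_ring V" by unfold_locales
    show "Module.module class_ring V" by unfold_locales
    show "?C \<subseteq> carrier V" using code_subset[of k vs] n by simp
    show "\<zero>\<^bsub>V\<^esub> \<in> ?C" using encode_zero[OF vs] n unfolding code_def
      by (simp add: image_iff) (metis zero_carrier_vec)
    fix v w assume v: "v \<in> ?C"
    then obtain x where x: "x \<in> carrier_vec k" "v = encode vs x" unfolding code_def by blast
    {
      assume "w \<in> ?C"
      then obtain y where y: "y \<in> carrier_vec k" "w = encode vs y" unfolding code_def by blast
      have "v + w = encode vs (x + y)" using x y encode_add[OF vs] by simp
      then show "v \<oplus>\<^bsub>V\<^esub> w \<in> ?C" unfolding code_def using x y by simp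
    }
    fix c :: 'a
    have "c \<cdot>\<^sub>v v = encode vs (c \<cdot>\<^sub>v x)" using x encode_smult[OF vs] by simp
    then show "c \<odot>\<^bsub>V\<^esub> v \<in> ?C" unfolding code_def using x by simp
  qed
  then obtain d where lin: "linear_code n d ?C" unfolding linear_code_def by blast
  obtain ws where ws: "inj_on (encode ws) (carrier_vec d)" "?C = code d ws"
    using linear_code_columns[OF lin] by metis
  have "CARD('a) ^ d = card ?C"
    unfolding ws(2) using ws(1) by (simp add: code_def card_image card_carrier_vec)
  also have "\<dots> = CARD('a) ^ k"
    using inj by (simp add: code_def card_image card_carrier_vec)
  finally have "d = k" using card_field_gt_1[where 'a = 'a] by simp
  with lin show ?thesis by simp
qed

text \<open>The condition on a column list under which it generates an LCD code of dimension \<open>k\<close> and minimum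
weight \<open>d\<close>. Nondegeneracy of the Gram form accounts for the dimension as well as for LCD.\<close>

definition lcd_columns :: "nat \<Rightarrow> nat \<Rightarrow> 'a :: field vec list \<Rightarrow> bool" where
  "lcd_columns k d vs \<longleftrightarrow> set vs \<subseteq> carrier_vec k \<and> nondegenerate k vs \<and>
     (\<forall>x\<in>carrier_vec k - {0\<^sub>v k}. d \<le> weight vs x) \<and> (\<exists>x\<in>carrier_vec k - {0\<^sub>v k}. weight vs x = d)"

lemma code_mem_lcd_codes:
  fixes vs :: "'a :: {field, finite} vec list"
  assumes "lcd_columns k d vs" "length vs = n"
  shows "code k vs \<in> lcd_codes n k d"
  using assms nondegenerate_inj LCD_code_iff min_weight_code_iff linear_code_code
  unfolding lcd_codes_def lcd_columns_def by blast

lemma lcd_codes_columns: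
  fixes C :: "'a :: {field, finite} vec set"
  assumes C: "C \<in> lcd_codes n k d"
  obtains vs where "length vs = n" "lcd_columns k d vs" "C = code k vs"
proof -
  obtain vs where vs: "length vs = n" "set vs \<subseteq> carrier_vec k" "inj_on (encode vs) (carrier_vec k)"
    "C = code k vs"
    using C linear_code_columns unfolding lcd_codes_def by blast
  have "lcd_columns k d vs" using C vs LCD_code_iff[OF vs(2,1)] min_weight_code_iff[OF vs(2,3)]
    unfolding lcd_codes_def lcd_columns_def by blast
  with vs show thesis using that by blast
qed

lemma lcd_codes_dual2_columns:
  fixes C :: "'a :: {field, finite} vec set"
  assumes C: "C \<in> lcd_codes_dual2 n k d"
  obtains vs where "length vs = n" "lcd_columns k d vs" "0\<^sub>v k \<notin> set vs" "C = code k vs"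
proof -
  have C': "C \<in> lcd_codes n k d" "2 \<le> dual_distance n C" using C unfolding lcd_codes_dual2_def by auto
  obtain vs where vs: "length vs = n" "lcd_columns k d vs" "C = code k vs"
    using lcd_codes_columns[OF C'(1)] .
  then have "0\<^sub>v k \<notin> set vs"
    using dual_distance_code_iff[of vs k n] C'(2) unfolding lcd_columns_def by blast
  with vs show thesis using that by blast
qed

lemma code_mem_lcd_codes_dual2:
  fixes vs :: "'a :: {field, finite} vec list"
  assumes "lcd_columns k d vs" "length vs = n" "0\<^sub>v k \<notin> set vs"
  shows "code k vs \<in> lcd_codes_dual2 n k d"
  using assms code_mem_lcd_codes[OF assms(1,2)] dual_distance_code_iff[of vs k n]
  unfolding lcd_codes_dual2_def lcd_columns_def by blast

section \<open>Equivalence of codes as projective equivalence of columns\<close>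

text \<open>The row-vector product \<open>c P\<close> for the monomial matrix \<open>P\<close> whose only nonzero entry in column \<open>j\<close> is
\<open>a j\<close>, in row \<open>\<pi> j\<close>.\<close>

definition monomial_map :: "nat \<Rightarrow> (nat \<Rightarrow> nat) \<Rightarrow> (nat \<Rightarrow> 'a :: field) \<Rightarrow> 'a vec \<Rightarrow> 'a vec" where
  "monomial_map n \<pi> a c = vec n (\<lambda>j. a j * c $ \<pi> j)"

lemma monomial_mat_imp_map:
  fixes P :: "'a :: field mat"
  assumes P: "monomial_mat n P"
  obtains \<pi> a where "\<pi> permutes {..<n}" "\<forall>j<n. a j \<noteq> 0"
    "\<And>c. c \<in> carrier_vec n \<Longrightarrow> transpose_mat P *\<^sub>v c = monomial_map n \<pi> a c"
proof -
  have PC: "P \<in> carrier_mat n n" using P unfolding monomial_mat_def by blast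
  have rows: "\<forall>i<n. \<exists>!j. j < n \<and> P $$ (i, j) \<noteq> 0"
    by (rule P[unfolded monomial_mat_def, THEN conjunct2, THEN conjunct1])
  have cols: "\<forall>j<n. \<exists>!i. i < n \<and> P $$ (i, j) \<noteq> 0"
    by (rule P[unfolded monomial_mat_def, THEN conjunct2, THEN conjunct2])
  define \<pi> where "\<pi> j = (if j < n then (THE i. i < n \<and> P $$ (i, j) \<noteq> 0) else j)" for j
  have \<pi>: "\<pi> j < n" "P $$ (\<pi> j, j) \<noteq> 0" "\<And>i. i < n \<Longrightarrow> P $$ (i, j) \<noteq> 0 \<Longrightarrow> i = \<pi> j" if "j < n" for j
  proof -
    have ex: "\<exists>!i. i < n \<and> P $$ (i, j) \<noteq> 0" by (rule cols[rule_format, OF that])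
    have e: "\<pi> j = (THE i. i < n \<and> P $$ (i, j) \<noteq> 0)" using that by (simp add: \<pi>_def)
    show "\<pi> j < n" "P $$ (\<pi> j, j) \<noteq> 0" using theI'[OF ex] unfolding e by blast+
    show "\<And>i. i < n \<Longrightarrow> P $$ (i, j) \<noteq> 0 \<Longrightarrow> i = \<pi> j" using the1_equality[OF ex] unfolding e by blast
  qed
  have inj: "inj_on \<pi> {..<n}"
  proof (rule inj_onI)
    fix i j assume "i \<in> {..<n}" "j \<in> {..<n}" "\<pi> i = \<pi> j"
    then have ij: "i < n" "j < n" "P $$ (\<pi> i, i) \<noteq> 0" "P $$ (\<pi> i, j) \<noteq> 0" "\<pi> i < n"
      using \<pi>(1,2)[of i] \<pi>(2)[of j] by auto
    obtain u where "u < n \<and> P $$ (\<pi> i, u) \<noteq> 0"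
      and u: "\<forall>j. j < n \<and> P $$ (\<pi> i, j) \<noteq> 0 \<longrightarrow> j = u"
      using rows[rule_format, OF ij(5)] by (rule ex1E)
    show "i = j" using u[rule_format, OF conjI, OF ij(1,3)] u[rule_format, OF conjI, OF ij(2,4)] by simp
  qed
  have "\<pi> ` {..<n} = {..<n}" by (rule endo_inj_surj) (use \<pi>(1) inj in auto)
  then have perm: "\<pi> permutes {..<n}"
    using inj by (intro bij_imp_permutes) (auto simp: bij_betw_def \<pi>_def)
  show thesis
  proof (rule that[OF perm, of "\<lambda>j. P $$ (\<pi> j, j)"])
    show "\<forall>j<n. P $$ (\<pi> j, j) \<noteq> 0" using \<pi>(2) by blast
    fix c :: "'a vec" assume c: "c \<in> carrier_vec n"
    show "transpose_mat P *\<^sub>v c = monomial_map n \<pi> (\<lambda>j. P $$ (\<pi> j, j)) c"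
    proof (rule eq_vecI)
      fix j assume "j < dim_vec (monomial_map n \<pi> (\<lambda>j. P $$ (\<pi> j, j)) c)"
      then have j: "j < n" by (simp add: monomial_map_def)
      have "(transpose_mat P *\<^sub>v c) $ j = (\<Sum>i\<in>{0..<n}. P $$ (i, j) * c $ i)"
        using PC c j by (simp add: scalar_prod_def)
      also have "\<dots> = (\<Sum>i\<in>{\<pi> j}. P $$ (i, j) * c $ i)"
      proof (rule sum.mono_neutral_right)
        show "\<forall>i\<in>{0..<n} - {\<pi> j}. P $$ (i, j) * c $ i = 0"
        proof
          fix i assume "i \<in> {0..<n} - {\<pi> j}"
          then have "P $$ (i, j) = 0" using \<pi>(3)[OF j, of i] by auto
          then show "P $$ (i, j) * c $ i = 0" by simp
        qed
      qed (use \<pi>(1)[OF j] in auto)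
      finally show "(transpose_mat P *\<^sub>v c) $ j = monomial_map n \<pi> (\<lambda>j. P $$ (\<pi> j, j)) c $ j"
        using j by (simp add: monomial_map_def)
    qed (use PC in \<open>simp add: monomial_map_def\<close>)
  qed
qed

lemma monomial_map_imp_mat:
  fixes a :: "nat \<Rightarrow> 'a :: field"
  assumes \<pi>: "\<pi> permutes {..<n}" and a: "\<forall>j<n. a j \<noteq> 0"
  obtains P where "monomial_mat n P"
    "\<And>c. c \<in> carrier_vec n \<Longrightarrow> transpose_mat P *\<^sub>v c = monomial_map n \<pi> a c"
proof -
  define P where "P = mat n n (\<lambda>(i, j). if i = \<pi> j then a j else 0)"
  have PC: "P \<in> carrier_mat n n" by (simp add: P_def)
  have \<pi>n: "\<pi> j < n" if "j < n" for j using permutes_in_image[OF \<pi>, of j] that by simp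
  have ex: "\<exists>!j. j < n \<and> \<pi> j = i" if "i < n" for i
  proof -
    have "i \<in> \<pi> ` {..<n}" using permutes_image[OF \<pi>] that by simp
    then show ?thesis using permutes_inj[OF \<pi>] by (auto dest: injD)
  qed
  show thesis
  proof (rule that[of P])
    show "monomial_mat n P" unfolding monomial_mat_def
    proof (intro conjI allI impI PC)
      fix i assume i: "i < n"
      have "(j < n \<and> P $$ (i, j) \<noteq> 0) \<longleftrightarrow> (j < n \<and> \<pi> j = i)" for j
        using i a by (auto simp: P_def split: if_splits)
      then show "\<exists>!j. j < n \<and> P $$ (i, j) \<noteq> 0" using ex[OF i] by simp
    next
      fix j assume j: "j < n"
      then show "\<exists>!i. i < n \<and> P $$ (i, j) \<noteq> 0" using a \<pi>n by (intro ex1I[of _ "\<pi> j"]) (auto simp: P_def split: if_splits)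
    qed
    fix c :: "'a vec" assume c: "c \<in> carrier_vec n"
    show "transpose_mat P *\<^sub>v c = monomial_map n \<pi> a c"
    proof (rule eq_vecI)
      fix j assume "j < dim_vec (monomial_map n \<pi> a c)"
      then have j: "j < n" by (simp add: monomial_map_def)
      have "(transpose_mat P *\<^sub>v c) $ j = (\<Sum>i\<in>{0..<n}. P $$ (i, j) * c $ i)"
        using PC c j by (simp add: scalar_prod_def)
      also have "\<dots> = (\<Sum>i\<in>{\<pi> j}. P $$ (i, j) * c $ i)"
        by (rule sum.mono_neutral_right) (use \<pi>n j in \<open>auto simp: P_def\<close>)
      finally show "(transpose_mat P *\<^sub>v c) $ j = monomial_map n \<pi> a c $ j"
        using j \<pi>n by (simp add: monomial_map_def P_def)
    qed (use PC in \<open>simp add: monomial_map_def\<close>)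
  qed
qed

lemma linear_code_subset: "linear_code n k (C :: 'a :: field vec set) \<Longrightarrow> C \<subseteq> carrier_vec n"
proof -
  assume "linear_code n k C"
  then have "submodule class_ring C (module_vec TYPE('a) n)"
    unfolding linear_code_def by (simp add: VectorSpace.subspace_def)
  from submodule.subset[OF this] show "C \<subseteq> carrier_vec n" by (simp add: module_vec_def)
qed

lemma code_equiv_iff:
  "(C1, C2) \<in> code_equiv n k \<longleftrightarrow> linear_code n k C1 \<and> linear_code n k C2 \<and>
     (\<exists>\<pi> a. \<pi> permutes {..<n} \<and> (\<forall>j<n. a j \<noteq> 0) \<and> C2 = monomial_map n \<pi> a ` C1)"
proof -
  have *: "(\<exists>P. monomial_mat n P \<and> C2 = (\<lambda>c. transpose_mat P *\<^sub>v c) ` C1) \<longleftrightarrow>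
      (\<exists>\<pi> a. \<pi> permutes {..<n} \<and> (\<forall>j<n. a j \<noteq> 0) \<and> C2 = monomial_map n \<pi> a ` C1)"
    if C1: "C1 \<subseteq> carrier_vec n"
  proof
    assume "\<exists>P. monomial_mat n P \<and> C2 = (\<lambda>c. transpose_mat P *\<^sub>v c) ` C1"
    then obtain P where P: "monomial_mat n P" "C2 = (\<lambda>c. transpose_mat P *\<^sub>v c) ` C1" by blast
    obtain \<pi> a where m: "\<pi> permutes {..<n}" "\<forall>j<n. a j \<noteq> 0"
      "\<And>c. c \<in> carrier_vec n \<Longrightarrow> transpose_mat P *\<^sub>v c = monomial_map n \<pi> a c"
      using monomial_mat_imp_map[OF P(1)] by metis
    have "C2 = monomial_map n \<pi> a ` C1" unfolding P(2) by (rule image_cong) (use m(3) C1 in auto)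
    with m(1,2) show "\<exists>\<pi> a. \<pi> permutes {..<n} \<and> (\<forall>j<n. a j \<noteq> 0) \<and> C2 = monomial_map n \<pi> a ` C1"
      by blast
  next
    assume "\<exists>\<pi> a. \<pi> permutes {..<n} \<and> (\<forall>j<n. a j \<noteq> 0) \<and> C2 = monomial_map n \<pi> a ` C1"
    then obtain \<pi> a where m: "\<pi> permutes {..<n}" "\<forall>j<n. a j \<noteq> 0" "C2 = monomial_map n \<pi> a ` C1"
      by blast
    obtain P where P: "monomial_mat n P"
      "\<And>c. c \<in> carrier_vec n \<Longrightarrow> transpose_mat P *\<^sub>v c = monomial_map n \<pi> a c"
      using monomial_map_imp_mat[OF m(1,2)] by metis
    have "C2 = (\<lambda>c. transpose_mat P *\<^sub>v c) ` C1" unfolding m(3)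
      by (rule image_cong) (use P(2) C1 in auto)
    with P(1) show "\<exists>P. monomial_mat n P \<and> C2 = (\<lambda>c. transpose_mat P *\<^sub>v c) ` C1" by blast
  qed
  show ?thesis
  proof (cases "linear_code n k C1")
    case True
    then show ?thesis unfolding code_equiv_def by (simp add: *[OF linear_code_subset[OF True]])
  qed (simp add: code_equiv_def)
qed

lemma code_equivI:
  assumes "linear_code n k C1" "linear_code n k C2" "\<pi> permutes {..<n}" "\<And>j. j < n \<Longrightarrow> a j \<noteq> 0"
    and "C2 = monomial_map n \<pi> a ` C1"
  shows "(C1, C2) \<in> code_equiv n k"
  unfolding code_equiv_iff
  by (intro conjI exI[of _ \<pi>] exI[of _ a] allI impI) (use assms in auto)

lemma equiv_code_equiv: "equiv {C :: 'a :: field vec set. linear_code n k C} (code_equiv n k)"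
proof (rule equivI)
  show "code_equiv n k \<subseteq> {C :: 'a vec set. linear_code n k C} \<times> {C. linear_code n k C}"
    by (auto simp: code_equiv_def)
  show "refl_on {C :: 'a vec set. linear_code n k C} (code_equiv n k)"
  proof (rule refl_onI)
    fix C :: "'a vec set" assume "C \<in> {C. linear_code n k C}"
    then have C: "linear_code n k C" by simp
    have "monomial_map n id (\<lambda>_. 1) c = c" if "c \<in> C" for c
      using linear_code_subset[OF C] that by (intro eq_vecI) (auto simp: monomial_map_def)
    then have "C = monomial_map n id (\<lambda>_. 1) ` C" by simp
    then show "(C, C) \<in> code_equiv n k" using C permutes_id by (intro code_equivI) auto
  qed
  show "sym (code_equiv n k :: ('a vec set \<times> 'a vec set) set)"
  proof (rule symI)
    fix C1 C2 :: "'a vec set" assume "(C1, C2) \<in> code_equiv n k"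
    then obtain \<pi> a where m: "linear_code n k C1" "linear_code n k C2"
      "\<pi> permutes {..<n}" "\<forall>j<n. a j \<noteq> 0" "C2 = monomial_map n \<pi> a ` C1"
      unfolding code_equiv_iff by blast
    define \<sigma> where "\<sigma> = Hilbert_Choice.inv \<pi>"
    have \<sigma>: "\<sigma> permutes {..<n}" "\<And>j. \<pi> (\<sigma> j) = j" unfolding \<sigma>_def
      using permutes_inv[OF m(3)] permutes_inverses(1)[OF m(3)] by auto
    have \<sigma>n: "\<sigma> j < n" if "j < n" for j using permutes_in_image[OF \<sigma>(1), of j] that by simp
    have "monomial_map n \<sigma> (\<lambda>j. 1 / a (\<sigma> j)) (monomial_map n \<pi> a c) = c" if "c \<in> C1" for c
      using linear_code_subset[OF m(1)] that \<sigma>(2) \<sigma>n m(4)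
      by (intro eq_vecI) (auto simp: monomial_map_def)
    then have "C1 = monomial_map n \<sigma> (\<lambda>j. 1 / a (\<sigma> j)) ` C2" unfolding m(5) image_image by simp
    moreover have "1 / a (\<sigma> j) \<noteq> 0" if "j < n" for j using m(4) \<sigma>n[OF that] by simp
    ultimately show "(C2, C1) \<in> code_equiv n k" using m(1,2) \<sigma>(1) by (intro code_equivI)
  qed
  show "trans (code_equiv n k :: ('a vec set \<times> 'a vec set) set)"
  proof (rule transI)
    fix C1 C2 C3 :: "'a vec set" assume "(C1, C2) \<in> code_equiv n k" "(C2, C3) \<in> code_equiv n k"
    then obtain \<pi> a \<sigma> b where m: "linear_code n k C1" "linear_code n k C3"
      "\<pi> permutes {..<n}" "\<forall>j<n. a j \<noteq> 0" "C2 = monomial_map n \<pi> a ` C1"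
      "\<sigma> permutes {..<n}" "\<forall>j<n. b j \<noteq> 0" "C3 = monomial_map n \<sigma> b ` C2"
      unfolding code_equiv_iff by blast
    have \<sigma>n: "\<sigma> j < n" if "j < n" for j using permutes_in_image[OF m(6), of j] that by simp
    have "monomial_map n \<sigma> b (monomial_map n \<pi> a c) = monomial_map n (\<pi> \<circ> \<sigma>) (\<lambda>j. b j * a (\<sigma> j)) c" for c
      using \<sigma>n by (intro eq_vecI) (auto simp: monomial_map_def)
    then have "C3 = monomial_map n (\<pi> \<circ> \<sigma>) (\<lambda>j. b j * a (\<sigma> j)) ` C1" unfolding m(5,8) image_image by simp
    moreover have "b j * a (\<sigma> j) \<noteq> 0" if "j < n" for j using m(4,7) \<sigma>n[OF that] that by simp
    moreover have "\<pi> \<circ> \<sigma> permutes {..<n}" by (rule permutes_compose[OF m(6,3)])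
    ultimately show "(C1, C3) \<in> code_equiv n k" using m(1,2) by (intro code_equivI)
  qed
qed

text \<open>Projective equivalence of two column lists. \<open>L\<close> acts on messages and \<open>N\<close> is its adjoint, acting on
columns. The adjunction forces both maps to be linear, and surjectivity of \<open>L\<close> makes \<open>N\<close>
injective, so the definition does without matrices.\<close>

definition columns_equiv :: "nat \<Rightarrow> 'a :: field vec list \<Rightarrow> 'a vec list \<Rightarrow> bool" where
  "columns_equiv k vs ws \<longleftrightarrow> (\<exists>L N. L ` carrier_vec k = carrier_vec k \<and> N ` carrier_vec k \<subseteq> carrier_vec k \<and>
     (\<forall>w\<in>carrier_vec k. \<forall>x\<in>carrier_vec k. w \<bullet> L x = N w \<bullet> x) \<and>
     mset (map (\<lambda>w. projpoint (N w)) ws) = mset (map projpoint vs))"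

text \<open>Equal multisets of points provide a permutation \<open>\<pi>\<close> with \<open>N (ws ! j)\<close> proportional to \<open>vs ! \<pi> j\<close>. By
adjunction the codeword of \<open>L x\<close> under \<open>ws\<close> is then the monomial image of the codeword of \<open>x\<close>
under \<open>vs\<close>, and \<open>L\<close> reaches all messages.\<close>

lemma columns_equiv_imp_code_equiv:
  fixes vs ws :: "'a :: {field, finite} vec list"
  assumes vs: "set vs \<subseteq> carrier_vec k" "length vs = n" "inj_on (encode vs) (carrier_vec k)"
    and ws: "set ws \<subseteq> carrier_vec k" "length ws = n" "inj_on (encode ws) (carrier_vec k)"
    and eq: "columns_equiv k vs ws"
  shows "(code k vs, code k ws) \<in> code_equiv n k"
proof -
  obtain L N where L: "L ` carrier_vec k = carrier_vec k" and N: "N ` carrier_vec k \<subseteq> carrier_vec k"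
    and adj: "\<And>w x. w \<in> carrier_vec k \<Longrightarrow> x \<in> carrier_vec k \<Longrightarrow> w \<bullet> L x = N w \<bullet> x"
    and m: "mset (map (\<lambda>w. projpoint (N w)) ws) = mset (map projpoint vs)"
    using eq unfolding columns_equiv_def by blast
  obtain \<pi> where \<pi>: "\<pi> permutes {..<n}" "permute_list \<pi> (map projpoint vs) = map (\<lambda>w. projpoint (N w)) ws"
    using mset_eq_permutation[OF m] vs(2) by auto
  have \<pi>n: "\<pi> j < n" if "j < n" for j using permutes_in_image[OF \<pi>(1), of j] that by simp
  have vsc: "vs ! j \<in> carrier_vec k" if "j < n" for j using that vs nth_mem by blast
  have wsc: "ws ! j \<in> carrier_vec k" if "j < n" for j using that ws nth_mem by blast
  have "\<exists>c. c \<noteq> 0 \<and> N (ws ! j) = c \<cdot>\<^sub>v (vs ! \<pi> j)" if j: "j < n" for j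
  proof -
    have "projpoint (N (ws ! j)) = permute_list \<pi> (map projpoint vs) ! j"
      unfolding \<pi>(2) using j ws(2) by simp
    also have "\<dots> = projpoint (vs ! \<pi> j)"
      using permute_list_nth[of \<pi> "map projpoint vs" j] \<pi> \<pi>n j vs(2) by simp
    finally show ?thesis by (simp only: projpoint_eq_iff)
  qed
  then obtain a where a: "\<forall>j<n. a j \<noteq> 0 \<and> N (ws ! j) = a j \<cdot>\<^sub>v (vs ! \<pi> j)" by metis
  have "encode ws (L x) = monomial_map n \<pi> a (encode vs x)" if x: "x \<in> carrier_vec k" for x
  proof (rule eq_vecI)
    fix j assume "j < dim_vec (monomial_map n \<pi> a (encode vs x))"
    then have j: "j < n" by (simp add: monomial_map_def)
    have "ws ! j \<bullet> L x = a j * (vs ! \<pi> j \<bullet> x)"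
      using adj[OF wsc[OF j] x] vsc[OF \<pi>n[OF j]] x a j by simp
    then show "encode ws (L x) $ j = monomial_map n \<pi> a (encode vs x) $ j"
      using j \<pi>n[OF j] vs(2) ws(2) by (simp add: encode_def monomial_map_def)
  qed (simp add: encode_def monomial_map_def ws(2))
  then have "encode ws ` L ` carrier_vec k = monomial_map n \<pi> a ` encode vs ` carrier_vec k"
    unfolding image_image by (intro image_cong) auto
  then have "code k ws = monomial_map n \<pi> a ` code k vs" unfolding L code_def .
  then show ?thesis
    using linear_code_code[OF vs(1,3,2)] linear_code_code[OF ws(1,3,2)] \<pi>(1) a
    by (intro code_equivI) auto
qed

text \<open>The monomial map sends codewords of \<open>vs\<close> to codewords of \<open>ws\<close> and thereby induces a map on
messages. It is realized by a matrix \<open>M\<close> with the images of the unit messages as columns, and the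
transpose of \<open>M\<close> acts on the columns of the generator matrices.\<close>

lemma code_equiv_imp_columns_equiv:
  fixes vs ws :: "'a :: {field, finite} vec list"
  assumes vs: "set vs \<subseteq> carrier_vec k" "length vs = n"
    and ws: "set ws \<subseteq> carrier_vec k" "length ws = n" "inj_on (encode ws) (carrier_vec k)"
    and eq: "(code k vs, code k ws) \<in> code_equiv n k"
  shows "columns_equiv k vs ws"
proof -
  obtain \<pi> a where \<pi>: "\<pi> permutes {..<n}" and a: "\<forall>j<n. a j \<noteq> 0"
    and img: "code k ws = monomial_map n \<pi> a ` code k vs"
    using eq unfolding code_equiv_iff by blast
  have \<pi>n: "\<pi> j < n" if "j < n" for j using permutes_in_image[OF \<pi>, of j] that by simp
  have vsc: "vs ! j \<in> carrier_vec k" if "j < n" for j using that vs nth_mem by blast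
  have wsc: "ws ! j \<in> carrier_vec k" if "j < n" for j using that ws nth_mem by blast
  have "\<exists>y\<in>carrier_vec k. encode ws y = monomial_map n \<pi> a (encode vs x)" if "x \<in> carrier_vec k" for x
  proof -
    have "encode vs x \<in> code k vs" using that unfolding code_def by blast
    then have "monomial_map n \<pi> a (encode vs x) \<in> code k ws" unfolding img by (rule imageI)
    then show ?thesis unfolding code_def by auto
  qed
  then obtain G where G: "\<And>x. x \<in> carrier_vec k \<Longrightarrow> G x \<in> carrier_vec k"
    "\<And>x. x \<in> carrier_vec k \<Longrightarrow> encode ws (G x) = monomial_map n \<pi> a (encode vs x)" by metis
  define M where "M = mat_of_cols k (map (\<lambda>i. G (unit_vec k i)) [0..<k])"
  have M: "M \<in> carrier_mat k k"
    using mat_of_cols_carrier(1)[of k "map (\<lambda>i. G (unit_vec k i)) [0..<k]"] unfolding M_def by simp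
  have colM: "col M i = G (unit_vec k i)" if "i < k" for i
    unfolding M_def using that G(1) by (subst col_mat_of_cols) auto
  define L N where "L x = M *\<^sub>v x" and "N w = transpose_mat M *\<^sub>v w" for x w
  have Lc: "L x \<in> carrier_vec k" if "x \<in> carrier_vec k" for x using M that unfolding L_def by simp
  have Nc: "N w \<in> carrier_vec k" if "w \<in> carrier_vec k" for w using M that unfolding N_def by simp
  have adj: "w \<bullet> L x = N w \<bullet> x" if "w \<in> carrier_vec k" "x \<in> carrier_vec k" for w x
    unfolding L_def N_def using transpose_vec_mult_scalar[OF M that(2,1)] by simp
  have Nw: "N (ws ! j) = a j \<cdot>\<^sub>v (vs ! \<pi> j)" if j: "j < n" for j
  proof (rule eq_vecI)
    fix i assume "i < dim_vec (a j \<cdot>\<^sub>v (vs ! \<pi> j))"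
    then have i: "i < k" using vsc[OF \<pi>n[OF j]] by simp
    have "N (ws ! j) $ i = G (unit_vec k i) \<bullet> ws ! j" unfolding N_def using M i colM by simp
    also have "\<dots> = ws ! j \<bullet> G (unit_vec k i)" using comm_scalar_prod[OF G(1) wsc[OF j]] by simp
    also have "\<dots> = encode ws (G (unit_vec k i)) $ j" using j ws(2) by (simp add: encode_def)
    also have "\<dots> = a j * (vs ! \<pi> j \<bullet> unit_vec k i)"
      unfolding G(2)[OF unit_vec_carrier] using j \<pi>n[OF j] vs(2)
      by (simp add: monomial_map_def encode_def)
    also have "\<dots> = (a j \<cdot>\<^sub>v (vs ! \<pi> j)) $ i" using i vsc[OF \<pi>n[OF j]] by simp
    finally show "N (ws ! j) $ i = (a j \<cdot>\<^sub>v (vs ! \<pi> j)) $ i" .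
  qed (use Nc[OF wsc[OF j]] vsc[OF \<pi>n[OF j]] in simp)
  have enc: "encode ws (L x) = monomial_map n \<pi> a (encode vs x)" if x: "x \<in> carrier_vec k" for x
  proof (rule eq_vecI)
    fix j assume "j < dim_vec (monomial_map n \<pi> a (encode vs x))"
    then have j: "j < n" by (simp add: monomial_map_def)
    have "ws ! j \<bullet> L x = a j * (vs ! \<pi> j \<bullet> x)"
      using adj[OF wsc[OF j] x] Nw[OF j] vsc[OF \<pi>n[OF j]] x by simp
    then show "encode ws (L x) $ j = monomial_map n \<pi> a (encode vs x) $ j"
      using j \<pi>n[OF j] vs(2) ws(2) by (simp add: encode_def monomial_map_def)
  qed (simp add: encode_def monomial_map_def ws(2))
  have "L ` carrier_vec k = carrier_vec k"
  proof (intro equalityI subsetI)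
    fix y assume "y \<in> L ` carrier_vec k" then show "y \<in> carrier_vec k" using Lc by blast
  next
    fix y :: "'a vec" assume y: "y \<in> carrier_vec k"
    then have "encode ws y \<in> code k ws" unfolding code_def by blast
    then have "encode ws y \<in> monomial_map n \<pi> a ` code k vs" unfolding img .
    then obtain x where x: "x \<in> carrier_vec k" "encode ws y = monomial_map n \<pi> a (encode vs x)"
      unfolding code_def by blast
    then have "y = L x" using enc[OF x(1)] ws(3) y Lc[OF x(1)] by (metis inj_onD)
    with x(1) show "y \<in> L ` carrier_vec k" by blast
  qed
  moreover have "mset (map (\<lambda>w. projpoint (N w)) ws) = mset (map projpoint vs)"
  proof -
    have "map (\<lambda>w. projpoint (N w)) ws = permute_list \<pi> (map projpoint vs)"
    proof (rule nth_equalityI)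
      fix j assume "j < length (map (\<lambda>w. projpoint (N w)) ws)"
      then have j: "j < n" using ws(2) by simp
      have "projpoint (N (ws ! j)) = projpoint (vs ! \<pi> j)"
        unfolding projpoint_eq_iff using Nw[OF j] a j by blast
      then show "map (\<lambda>w. projpoint (N w)) ws ! j = permute_list \<pi> (map projpoint vs) ! j"
        using permute_list_nth[of \<pi> "map projpoint vs" j] \<pi> \<pi>n j vs(2) ws(2) by simp
    qed (simp add: vs(2) ws(2))
    then show ?thesis using \<pi> vs(2) by simp
  qed
  ultimately show ?thesis unfolding columns_equiv_def using Nc adj by blast
qed

lemma dot_ext:
  fixes v w :: "'a :: comm_ring_1 vec"
  assumes "v \<in> carrier_vec k" "w \<in> carrier_vec k" "\<And>x. x \<in> carrier_vec k \<Longrightarrow> v \<bullet> x = w \<bullet> x"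
  shows "v = w"
proof (rule eq_vecI)
  fix i assume "i < dim_vec w"
  then have "i < k" using assms by simp
  then show "v $ i = w $ i" using assms(3)[of "unit_vec k i"] assms(1,2) by simp
qed (use assms in simp)

text \<open>An injective linear map permutes the points of projective space, each of which occurs once among
the simplex columns.\<close>

lemma projpoint_simplex_permuted:
  fixes N :: "'a :: {field, finite} vec \<Rightarrow> 'a vec"
  assumes L: "L ` carrier_vec k = carrier_vec k" and N: "N ` carrier_vec k \<subseteq> carrier_vec k"
    and adj: "\<forall>w\<in>carrier_vec k. \<forall>x\<in>carrier_vec k. w \<bullet> L x = N w \<bullet> x"
  shows "mset (map (\<lambda>w. projpoint (N w)) (simplex_columns k)) = mset (map projpoint (simplex_columns k))"
proof -
  let ?S = "simplex_columns k :: 'a vec list" and ?V = "carrier_vec k - {0\<^sub>v k} :: 'a vec set"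
  note S = simplex_columns[where 'a = 'a and k = k]
  have Lc: "L x \<in> carrier_vec k" if "x \<in> carrier_vec k" for x using L that by blast
  have Nc: "N w \<in> carrier_vec k" if "w \<in> carrier_vec k" for w using N that by blast
  have inj: "v = w" if vw: "v \<in> carrier_vec k" "w \<in> carrier_vec k" "N v = N w" for v w
  proof (rule dot_ext[OF vw(1,2)])
    fix y :: "'a vec" assume "y \<in> carrier_vec k"
    then obtain x where "x \<in> carrier_vec k" "y = L x" using L by blast
    then show "v \<bullet> y = w \<bullet> y" using adj vw by simp
  qed
  have smult: "N (a \<cdot>\<^sub>v w) = a \<cdot>\<^sub>v N w" if w: "w \<in> carrier_vec k" for a w
  proof (rule dot_ext)
    fix x :: "'a vec" assume x: "x \<in> carrier_vec k"
    have aw: "a \<cdot>\<^sub>v w \<in> carrier_vec k" using w by simp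
    have "N (a \<cdot>\<^sub>v w) \<bullet> x = (a \<cdot>\<^sub>v w) \<bullet> L x" using adj aw x by metis
    also have "\<dots> = a * (w \<bullet> L x)" using w Lc[OF x] by simp
    also have "\<dots> = a * (N w \<bullet> x)" using adj w x by simp
    also have "\<dots> = (a \<cdot>\<^sub>v N w) \<bullet> x" using Nc[OF w] x by simp
    finally show "N (a \<cdot>\<^sub>v w) \<bullet> x = (a \<cdot>\<^sub>v N w) \<bullet> x" .
  qed (use w Nc in auto)
  have zero: "N (0\<^sub>v k) = 0\<^sub>v k" 
  proof -
    have "0 \<cdot>\<^sub>v N (0\<^sub>v k) = 0\<^sub>v k" "0 \<cdot>\<^sub>v 0\<^sub>v k = (0\<^sub>v k :: 'a vec)"
      using Nc[of "0\<^sub>v k"] by (auto intro!: eq_vecI)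
    then show ?thesis using smult[of "0\<^sub>v k" 0] by simp
  qed
  have NV: "N v \<in> ?V" if "v \<in> ?V" for v using that Nc[of v] inj[of v "0\<^sub>v k"] zero by auto
  have "distinct (map (\<lambda>w. projpoint (N w)) ?S)"
    unfolding distinct_map
  proof
    show "distinct ?S" using S(2) by (simp add: distinct_map)
    show "inj_on (\<lambda>w. projpoint (N w)) (set ?S)"
    proof (rule inj_onI)
      fix v w assume vw: "v \<in> set ?S" "w \<in> set ?S" "projpoint (N v) = projpoint (N w)"
      then have c: "v \<in> carrier_vec k" "w \<in> carrier_vec k" using S(1) by blast+
      obtain a where a: "a \<noteq> 0" "N v = a \<cdot>\<^sub>v N w" using vw(3) unfolding projpoint_eq_iff by blast
      then have "v = a \<cdot>\<^sub>v w" using smult[OF c(2)] inj[OF c(1)] c(2) by simp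
      then have "projpoint v = projpoint w" using a(1) projpoint_eq_iff by blast
      then show "v = w" using S(2) vw(1,2) unfolding distinct_map inj_on_def by blast
    qed
  qed
  moreover have "set (map (\<lambda>w. projpoint (N w)) ?S) = set (map projpoint ?S)"
  proof (rule card_subset_eq)
    show "set (map (\<lambda>w. projpoint (N w)) ?S) \<subseteq> set (map projpoint ?S)"
    proof
      fix c assume "c \<in> set (map (\<lambda>w. projpoint (N w)) ?S)"
      then obtain w where "w \<in> set ?S" "c = projpoint (N w)" by auto
      then have "c \<in> projpoint ` ?V" using NV[of w] S(1) by blast
      then show "c \<in> set (map projpoint ?S)" using S(3) by simp
    qed
    show "card (set (map (\<lambda>w. projpoint (N w)) ?S)) = card (set (map projpoint ?S))"
      using distinct_card[OF S(2)] distinct_card[OF calculation] by simp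
  qed simp
  ultimately show ?thesis using S(2) set_eq_iff_mset_eq_distinct by blast
qed

text \<open>The maps that witness one side witness the other: the copies of the simplex columns contribute
the same submultiset before and after the map, and it cancels. Cancellation is what makes the
correspondence of classes injective.\<close>

lemma columns_equiv_add_simplex:
  fixes vs ws :: "'a :: {field, finite} vec list"
  shows "columns_equiv k (vs @ concat (replicate u (simplex_columns k))) (ws @ concat (replicate u (simplex_columns k)))
     \<longleftrightarrow> columns_equiv k vs ws"
proof -
  have copies: "mset (map f (concat (replicate u xs))) = mset (map g (concat (replicate u xs)))"
    if "mset (map f xs) = mset (map g xs)" for f g :: "'a vec \<Rightarrow> 'a vec set" and xs
    using that by (induction u) auto
  have "mset (map (\<lambda>w. projpoint (N w)) (ws @ concat (replicate u (simplex_columns k))))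
        = mset (map projpoint (vs @ concat (replicate u (simplex_columns k)))) \<longleftrightarrow>
      mset (map (\<lambda>w. projpoint (N w)) ws) = mset (map projpoint vs)"
    if "L ` carrier_vec k = carrier_vec k" "N ` carrier_vec k \<subseteq> carrier_vec k"
      "\<forall>w\<in>carrier_vec k. \<forall>x\<in>carrier_vec k. w \<bullet> L x = N w \<bullet> x" for L N
    unfolding map_append mset_append copies[OF projpoint_simplex_permuted[OF that]] by simp
  then show ?thesis unfolding columns_equiv_def by (intro ex_cong1) blast
qed

lemma columns_equiv_same_points:
  assumes "mset (map projpoint ws) = mset (map projpoint vs)"
  shows "columns_equiv k vs ws"
  unfolding columns_equiv_def using assms by (intro exI[of _ "\<lambda>x. x"]) simp

section \<open>Adding and removing copies of the simplex code\<close>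

lemma weight_cong:
  assumes vs: "set vs \<subseteq> carrier_vec k" and ws: "set ws \<subseteq> carrier_vec k"
    and m: "mset (map projpoint vs) = mset (map projpoint ws)" and x: "x \<in> carrier_vec k"
  shows "weight vs x = weight ws x"
proof -
  let ?f = "\<lambda>v. if v \<in> carrier_vec k then of_bool (v \<bullet> x \<noteq> 0) else 0 :: nat"
  have f: "weight us x = (\<Sum>v\<leftarrow>us. ?f v)" if "set us \<subseteq> carrier_vec k" for us
    unfolding weight_def by (rule arg_cong[where f = sum_list], rule map_cong) (use that in auto)
  show ?thesis unfolding f[OF vs] f[OF ws]
  proof (rule sum_list_projpoint_cong[OF _ m])
    fix v w :: "'a vec" assume "projpoint v = projpoint w"
    then show "?f v = ?f w" using x unfolding projpoint_eq_iff by auto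
  qed
qed

lemma gram_cong:
  fixes vs ws :: "'a :: {field, finite} vec list"
  assumes q: "CARD('a) \<in> {2, 3}" and vs: "set vs \<subseteq> carrier_vec k" and ws: "set ws \<subseteq> carrier_vec k"
    and m: "mset (map projpoint vs) = mset (map projpoint ws)"
    and x: "x \<in> carrier_vec k" and y: "y \<in> carrier_vec k"
  shows "gram vs x y = gram ws x y"
proof -
  let ?f = "\<lambda>v. if v \<in> carrier_vec k then (v \<bullet> x) * (v \<bullet> y) else 0"
  have f: "gram us x y = (\<Sum>v\<leftarrow>us. ?f v)" if "set us \<subseteq> carrier_vec k" for us
    unfolding gram_def by (rule arg_cong[where f = sum_list], rule map_cong) (use that in auto)
  show ?thesis unfolding f[OF vs] f[OF ws]
  proof (rule sum_list_projpoint_cong[OF _ m])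
    fix v w :: "'a vec" assume "projpoint v = projpoint w"
    then obtain a where a: "a \<noteq> 0" "v = a \<cdot>\<^sub>v w" unfolding projpoint_eq_iff by blast
    have "(a * b) * (a * c) = b * c" for b c
      using square_eq_one[OF q a(1)] by (metis mult.assoc mult.commute mult_1)
    then show "?f v = ?f w" using x y a(2) by simp
  qed
qed

lemma weight_nonzero_columns:
  "set ws \<subseteq> carrier_vec k \<Longrightarrow> x \<in> carrier_vec k \<Longrightarrow> weight (filter (\<lambda>v. v \<noteq> 0\<^sub>v k) ws) x = weight ws x"
  unfolding weight_def by (induction ws) auto

lemma gram_nonzero_columns:
  "set ws \<subseteq> carrier_vec k \<Longrightarrow> x \<in> carrier_vec k \<Longrightarrow> gram (filter (\<lambda>v. v \<noteq> 0\<^sub>v k) ws) x y = gram ws x y"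
  unfolding gram_def by (induction ws) auto

lemma sum_weight:
  assumes "finite H"
  shows "(\<Sum>x\<in>H. weight vs x) = (\<Sum>v\<leftarrow>vs. card {x \<in> H. v \<bullet> x \<noteq> 0})"
proof (induction vs)
  case (Cons v vs)
  have "(\<Sum>x\<in>H. of_bool (v \<bullet> x \<noteq> 0) :: nat) = card {x \<in> H. v \<bullet> x \<noteq> 0}"
    using assms by (simp add: of_bool_def sum.If_cases Int_def)
  then show ?case using Cons by (simp add: weight_def sum.distrib)
qed (simp add: weight_def)

text \<open>Double count the pairs of a message \<open>x\<close> with \<open>x \<bullet> p \<noteq> 0\<close> and a column \<open>v\<close> with \<open>v \<bullet> x \<noteq> 0\<close>. Each
such message has weight at least \<open>d\<close>. A column proportional to \<open>p\<close> meets all of them, any other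
nonzero column meets the proportion \<open>(q - 1) / q\<close> of them, and a zero column meets none.\<close>

lemma multiplicity_bound:
  fixes p :: "'a :: {field, finite} vec"
  assumes vs: "set vs \<subseteq> carrier_vec k" and p: "p \<in> carrier_vec k" "p \<noteq> 0\<^sub>v k"
    and d: "\<And>x. x \<in> carrier_vec k \<Longrightarrow> x \<noteq> 0\<^sub>v k \<Longrightarrow> d \<le> weight vs x"
  shows "CARD('a) * d \<le> count (mset (map projpoint vs)) (projpoint p)
           + (CARD('a) - 1) * length (filter (\<lambda>v. v \<noteq> 0\<^sub>v k) vs)"
proof -
  let ?q = "CARD('a)"
  define H where "H = {x \<in> carrier_vec k. x \<bullet> p \<noteq> 0}"
  define A where "A = (?q - 1) * ?q ^ k"
  let ?e = "\<lambda>v. of_bool (projpoint v = projpoint p) + (?q - 1) * of_bool (v \<noteq> 0\<^sub>v k) :: nat"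
  have finH: "finite H" unfolding H_def using finite_carrier_vec by simp
  have qH: "?q * card H = A" unfolding H_def A_def by (rule card_hyperplane(2)[OF p])
  have q1: "?q > 1" by (rule card_field_gt_1)
  \<comment> \<open>the contribution of one column, scaled by \<open>q^2\<close> to stay in the natural numbers\<close>
  have each: "?q * ?q * card {x \<in> H. v \<bullet> x \<noteq> 0} = A * ?e v" if v: "v \<in> carrier_vec k" for v
  proof -
    have comm: "{x \<in> H. v \<bullet> x \<noteq> 0} = {x \<in> carrier_vec k. x \<bullet> p \<noteq> 0 \<and> x \<bullet> v \<noteq> 0}"
      unfolding H_def using comm_scalar_prod[OF v] by auto
    consider "v = 0\<^sub>v k" | "v \<noteq> 0\<^sub>v k" "projpoint v = projpoint p"
      | "v \<noteq> 0\<^sub>v k" "projpoint v \<noteq> projpoint p" by blast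
    then show ?thesis
    proof cases
      case 1
      have "projpoint v \<noteq> projpoint p" unfolding projpoint_eq_iff using 1 smult_eq_zero_iff[OF p(1)] p(2)
        by metis
      moreover have "{x \<in> H. v \<bullet> x \<noteq> 0} = {}" using 1 unfolding H_def by auto
      ultimately show ?thesis using 1 by (simp add: card_eq_0_iff)
    next
      case 2
      have "{x \<in> H. v \<bullet> x \<noteq> 0} = H"
      proof (intro equalityI subsetI CollectI conjI)
        fix x assume "x \<in> H"
        then have "x \<in> carrier_vec k" "p \<bullet> x \<noteq> 0" unfolding H_def using comm_scalar_prod[OF _ p(1)] by auto
        then show "v \<bullet> x \<noteq> 0" using dot_eq_0_projpoint[OF 2(2) _ p(1)] by blast
      qed auto
      then show ?thesis using 2 qH q1 by simp
    next
      case 3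
      have np: "v \<noteq> c \<cdot>\<^sub>v p" for c
      proof
        assume "v = c \<cdot>\<^sub>v p"
        moreover from this have "c \<noteq> 0" using 3 p by auto
        ultimately show False using 3(2) projpoint_eq_iff by blast
      qed
      have "?q * card {x \<in> H. v \<bullet> x \<noteq> 0} = (?q - 1) * card H"
        unfolding comm unfolding H_def by (rule card_two_conditions[OF v p(1) np])
      then have "?q * ?q * card {x \<in> H. v \<bullet> x \<noteq> 0} = (?q - 1) * (?q * card H)"
        by (simp only: mult.assoc mult.left_commute[of ?q "?q - 1"])
      then show ?thesis using 3 qH by simp
    qed
  qed
  have sum_e: "(\<Sum>v\<leftarrow>us. ?e v) = count (mset (map projpoint us)) (projpoint p)
           + (?q - 1) * length (filter (\<lambda>v. v \<noteq> 0\<^sub>v k) us)" for us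
    by (induction us) (simp_all add: distrib_left)
  have "d * card H \<le> (\<Sum>x\<in>H. weight vs x)"
  proof -
    have "(\<Sum>x\<in>H. d) \<le> (\<Sum>x\<in>H. weight vs x)"
    proof (rule sum_mono)
      fix x assume "x \<in> H"
      then have x: "x \<in> carrier_vec k" "x \<bullet> p \<noteq> 0" unfolding H_def by auto
      then have "x \<noteq> 0\<^sub>v k" using p by (intro notI) simp
      then show "d \<le> weight vs x" using d x by blast
    qed
    then show ?thesis by (simp add: mult.commute)
  qed
  then have "?q * ?q * (d * card H) \<le> ?q * ?q * (\<Sum>v\<leftarrow>vs. card {x \<in> H. v \<bullet> x \<noteq> 0})"
    unfolding sum_weight[OF finH] by (rule mult_le_mono2)
  also have "\<dots> = (\<Sum>v\<leftarrow>vs. ?q * ?q * card {x \<in> H. v \<bullet> x \<noteq> 0})"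
    by (simp add: sum_list_const_mult)
  also have "\<dots> = (\<Sum>v\<leftarrow>vs. A * ?e v)"
    by (rule arg_cong[where f = sum_list], rule map_cong[OF refl], rule each) (use vs in auto)
  also have "\<dots> = A * (\<Sum>v\<leftarrow>vs. ?e v)" by (rule sum_list_const_mult)
  also have "?q * ?q * (d * card H) = A * (?q * d)" unfolding qH[symmetric] by (simp only: ac_simps)
  finally have "A * (?q * d) \<le> A * (\<Sum>v\<leftarrow>vs. ?e v)" .
  moreover have "A > 0" unfolding A_def using q1 by simp
  ultimately show ?thesis unfolding sum_e by simp
qed

text \<open>The bound on multiplicities for the parameters of the theorem, with \<open>n\<close> in the role of \<open>q r\<close> and \<open>d\<close> in
that of \<open>(q - 1) r\<close>. By \<open>(q - 1) [k]_q = q^k - 1\<close> the quantity \<open>q d - (q - 1) n\<close>, which is 0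
here, increases by exactly 1 with every copy of the simplex columns, and every zero column adds
\<open>q - 1\<close>.\<close>

lemma simplex_multiplicity:
  fixes ws :: "'a :: {field, finite} vec list"
  assumes ws: "lcd_columns k (d + CARD('a) ^ (k - 1) * u) ws"
    and len: "length ws = n + q_bracket CARD('a) k * u" and nd: "CARD('a) * d = (CARD('a) - 1) * n"
    and k: "k \<ge> 1" and p: "p \<in> carrier_vec k - {0\<^sub>v k}"
  shows "u + (CARD('a) - 1) * (length ws - length (filter (\<lambda>v. v \<noteq> 0\<^sub>v k) ws))
    \<le> count (mset (map projpoint ws)) (projpoint p)"
proof -
  let ?q = "CARD('a)" and ?m = "count (mset (map projpoint ws)) (projpoint p)"
  let ?n' = "length (filter (\<lambda>v. v \<noteq> 0\<^sub>v k) ws)"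
  let ?z = "length ws - ?n'"
  have bound: "?q * (d + ?q ^ (k - 1) * u) \<le> ?m + (?q - 1) * ?n'"
    by (rule multiplicity_bound) (use ws p in \<open>auto simp: lcd_columns_def\<close>)
  have "?q * (d + ?q ^ (k - 1) * u) = (?q - 1) * n + ?q ^ k * u"
    using k nd by (simp add: distrib_left mult.assoc[symmetric] flip: power_Suc)
  moreover have "?q ^ k = (?q - 1) * q_bracket ?q k + 1"
    unfolding q_bracket_mult using card_field_gt_1[where 'a = 'a] by simp
  moreover have "m * n + (m * b + 1) * u = m * (n + b * u) + u" for m b :: nat
    by (simp add: algebra_simps)
  ultimately have "?q * (d + ?q ^ (k - 1) * u) = (?q - 1) * length ws + u"
    unfolding len by simp
  moreover have "length ws = ?n' + ?z" using length_filter_le[of "\<lambda>v. v \<noteq> 0\<^sub>v k" ws] by linarith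
  then have "(?q - 1) * length ws = (?q - 1) * ?n' + (?q - 1) * ?z" by (metis distrib_left)
  ultimately show ?thesis using bound by linarith
qed

text \<open>Points are removed from the multiset of projective points, and representatives of the remaining
ones are taken among the given columns. The result agrees with the given list only up to scaling
and order of the columns, that is, up to equivalence.\<close>

lemma ex_simplex_removed:
  fixes ws :: "'a :: {field, finite} vec list"
  assumes ws: "set ws \<subseteq> carrier_vec k"
    and u: "\<And>p. p \<in> carrier_vec k - {0\<^sub>v k} \<Longrightarrow> u \<le> count (mset (map projpoint ws)) (projpoint p)"
  obtains vs where "set vs \<subseteq> carrier_vec k - {0\<^sub>v k}"
    "mset (map projpoint (vs @ concat (replicate u (simplex_columns k))))
       = mset (map projpoint (filter (\<lambda>v. v \<noteq> 0\<^sub>v k) ws))"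
proof -
  let ?S = "simplex_columns k :: 'a vec list" and ?W = "filter (\<lambda>v. v \<noteq> 0\<^sub>v k) ws"
  note S = simplex_columns[where 'a = 'a and k = k]
  have cu: "count (mset (map projpoint (concat (replicate u ?S)))) c = u * count (mset (map projpoint ?S)) c" for c
    by (induction u) auto
  have cS: "count (mset (map projpoint ?S)) c = (if c \<in> projpoint ` (carrier_vec k - {0\<^sub>v k}) then 1 else 0)" for c
    using S(2) S(3) unfolding distinct_count_atmost_1 by simp
  have cW: "count (mset (map projpoint us)) (projpoint p) = count (mset (map projpoint (filter (\<lambda>v. v \<noteq> 0\<^sub>v k) us))) (projpoint p)"
    if p: "p \<in> carrier_vec k - {0\<^sub>v k}" for p us
  proof -
    have "projpoint (0\<^sub>v k) \<noteq> projpoint p"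
    proof
      assume "projpoint (0\<^sub>v k) = projpoint p"
      then obtain a where "a \<noteq> 0" "0\<^sub>v k = a \<cdot>\<^sub>v p" unfolding projpoint_eq_iff by blast
      then show False using p smult_eq_zero_iff[of p k a] by simp
    qed
    then show ?thesis by (induction us) auto
  qed
  have sub: "mset (map projpoint (concat (replicate u ?S))) \<subseteq># mset (map projpoint ?W)"
  proof (rule mset_subset_eqI)
    fix c show "count (mset (map projpoint (concat (replicate u ?S)))) c \<le> count (mset (map projpoint ?W)) c"
    proof (cases "c \<in> projpoint ` (carrier_vec k - {0\<^sub>v k})")
      case True
      then obtain p where p: "p \<in> carrier_vec k - {0\<^sub>v k}" "c = projpoint p" by blast
      show ?thesis unfolding cu cS using u[OF p(1)] cW[OF p(1), of ws] p(2) True by simp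
    next
      case False
      then show ?thesis unfolding cu cS by simp
    qed
  qed
  obtain cs where cs: "mset cs = mset (map projpoint ?W) - mset (map projpoint (concat (replicate u ?S)))"
    using ex_mset by blast
  define rep where "rep c = (SOME v. v \<in> set ?W \<and> projpoint v = c)" for c
  have rep: "rep c \<in> set ?W \<and> projpoint (rep c) = c" if "c \<in> set cs" for c
  proof -
    have "c \<in># mset (map projpoint ?W)" using that cs by (metis in_diffD set_mset_mset)
    then have "\<exists>v. v \<in> set ?W \<and> projpoint v = c" by auto
    from someI_ex[OF this] show ?thesis unfolding rep_def .
  qed
  have m: "map projpoint (map rep cs) = cs" using rep by (simp add: map_idI)
  show thesis
  proof (rule that[of "map rep cs"])
    show "set (map rep cs) \<subseteq> carrier_vec k - {0\<^sub>v k}" using rep ws by fastforce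
    show "mset (map projpoint (map rep cs @ concat (replicate u ?S))) = mset (map projpoint ?W)"
      unfolding map_append m mset_append cs by (rule subset_mset.diff_add[OF sub])
  qed
qed

lemma set_copies_subset: "set xs \<subseteq> A \<Longrightarrow> set (concat (replicate u xs)) \<subseteq> A"
  by auto

lemma nondegenerate_cong:
  assumes "\<And>x y. x \<in> carrier_vec k \<Longrightarrow> y \<in> carrier_vec k \<Longrightarrow> gram vs x y = gram ws x y"
  shows "nondegenerate k vs \<longleftrightarrow> nondegenerate k ws"
  unfolding nondegenerate_def by (simp only: assms cong: ball_cong)

text \<open>The simplex columns contribute nothing to the Gram form and the same amount to every weight.\<close>

lemma lcd_columns_add_simplex:
  fixes vs :: "'a :: {field, finite} vec list"
  assumes q: "CARD('a) = 2 \<and> k \<ge> 3 \<or> CARD('a) = 3 \<and> k \<ge> 2"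
  shows "lcd_columns k (d + CARD('a) ^ (k - 1) * u) (vs @ concat (replicate u (simplex_columns k)))
    \<longleftrightarrow> lcd_columns k d vs"
proof -
  let ?S = "simplex_columns k :: 'a vec list"
  have S: "set (concat (replicate u ?S)) \<subseteq> carrier_vec k"
    using simplex_columns(1)[of k] by (intro set_copies_subset) blast
  have w: "weight (vs @ concat (replicate u ?S)) x = weight vs x + CARD('a) ^ (k - 1) * u"
    if "x \<in> carrier_vec k - {0\<^sub>v k}" for x using that weight_simplex_columns[of x k] by simp
  have g: "gram (vs @ concat (replicate u ?S)) x y = gram vs x y"
    if "x \<in> carrier_vec k" "y \<in> carrier_vec k" for x y using gram_simplex_columns[OF q that] by simp
  have "set (vs @ concat (replicate u ?S)) \<subseteq> carrier_vec k \<longleftrightarrow> set vs \<subseteq> carrier_vec k" using S by auto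
  moreover have "nondegenerate k (vs @ concat (replicate u ?S)) \<longleftrightarrow> nondegenerate k vs"
    by (rule nondegenerate_cong[OF g])
  moreover have "(\<forall>x\<in>carrier_vec k - {0\<^sub>v k}. d + CARD('a) ^ (k - 1) * u \<le> weight (vs @ concat (replicate u ?S)) x)
     \<longleftrightarrow> (\<forall>x\<in>carrier_vec k - {0\<^sub>v k}. d \<le> weight vs x)"
    by (intro ball_cong refl) (simp only: w add_le_cancel_right)
  moreover have "(\<exists>x\<in>carrier_vec k - {0\<^sub>v k}. weight (vs @ concat (replicate u ?S)) x = d + CARD('a) ^ (k - 1) * u)
     \<longleftrightarrow> (\<exists>x\<in>carrier_vec k - {0\<^sub>v k}. weight vs x = d)"
    by (intro bex_cong refl) (simp only: w add_right_cancel)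
  ultimately show ?thesis unfolding lcd_columns_def by blast
qed

lemma lcd_columns_cong:
  fixes vs ws :: "'a :: {field, finite} vec list"
  assumes vs: "set vs \<subseteq> carrier_vec k" and ws: "set ws \<subseteq> carrier_vec k"
    and w: "\<And>x. x \<in> carrier_vec k \<Longrightarrow> weight vs x = weight ws x"
    and g: "\<And>x y. x \<in> carrier_vec k \<Longrightarrow> y \<in> carrier_vec k \<Longrightarrow> gram vs x y = gram ws x y"
  shows "lcd_columns k d vs \<longleftrightarrow> lcd_columns k d ws"
proof -
  have "nondegenerate k vs \<longleftrightarrow> nondegenerate k ws" by (rule nondegenerate_cong[OF g])
  then show ?thesis unfolding lcd_columns_def using vs ws w by auto
qed

lemma lcd_columns_remove_simplex:
  fixes ws :: "'a :: {field, finite} vec list"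
  assumes q: "CARD('a) = 2 \<and> k \<ge> 3 \<or> CARD('a) = 3 \<and> k \<ge> 2"
    and ws: "set ws \<subseteq> carrier_vec k"
    and u: "\<And>p. p \<in> carrier_vec k - {0\<^sub>v k} \<Longrightarrow> u \<le> count (mset (map projpoint ws)) (projpoint p)"
  obtains vs where "set vs \<subseteq> carrier_vec k - {0\<^sub>v k}"
    "mset (map projpoint (vs @ concat (replicate u (simplex_columns k))))
       = mset (map projpoint (filter (\<lambda>v. v \<noteq> 0\<^sub>v k) ws))"
    "length vs + q_bracket CARD('a) k * u = length (filter (\<lambda>v. v \<noteq> 0\<^sub>v k) ws)"
    "\<forall>x\<in>carrier_vec k - {0\<^sub>v k}. weight vs x + CARD('a) ^ (k - 1) * u = weight ws x"
    "\<forall>x\<in>carrier_vec k. \<forall>y\<in>carrier_vec k. gram vs x y = gram ws x y"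
proof -
  let ?S = "simplex_columns k :: 'a vec list" and ?W = "filter (\<lambda>v. v \<noteq> 0\<^sub>v k) ws"
  obtain vs where vs: "set vs \<subseteq> carrier_vec k - {0\<^sub>v k}"
    and m: "mset (map projpoint (vs @ concat (replicate u ?S))) = mset (map projpoint ?W)"
    using ex_simplex_removed[OF ws u] by blast
  have S: "set (concat (replicate u ?S)) \<subseteq> carrier_vec k"
    using simplex_columns(1)[of k] by (intro set_copies_subset) blast
  have sub: "set (vs @ concat (replicate u ?S)) \<subseteq> carrier_vec k" using vs S by auto
  have W: "set ?W \<subseteq> carrier_vec k" using ws by auto
  have "length (map projpoint (vs @ concat (replicate u ?S))) = length (map projpoint ?W)"
    by (rule mset_eq_length[OF m])
  then have len: "length vs + q_bracket CARD('a) k * u = length ?W"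
    by (simp add: length_simplex_columns mult.commute)
  have w: "weight vs x + CARD('a) ^ (k - 1) * u = weight ws x" if x: "x \<in> carrier_vec k - {0\<^sub>v k}" for x
    using weight_cong[OF sub W m, of x] weight_nonzero_columns[OF ws, of x] weight_simplex_columns[of x k] x
    by (simp add: mult.commute)
  have g: "gram vs x y = gram ws x y" if xy: "x \<in> carrier_vec k" "y \<in> carrier_vec k" for x y
    using gram_cong[OF _ sub W m xy] gram_nonzero_columns[OF ws xy(1), of y] gram_simplex_columns[OF q xy] q
    by auto
  show thesis using that[OF vs m len] w g by blast
qed

section \<open>The correspondence of equivalence classes\<close>

text \<open>A map that preserves and reflects equivalence and meets every class induces a bijection of
quotients. A class may contain elements outside \<open>A\<close>, so it is cut down to \<open>A\<close> before \<open>F\<close> is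
applied.\<close>

lemma quotient_bijection:
  assumes r: "equiv X r" and r': "equiv X' r'" and A: "A \<subseteq> X" and B: "B \<subseteq> X'"
    and F: "\<And>x. x \<in> A \<Longrightarrow> F x \<in> B"
    and iff: "\<And>x y. x \<in> A \<Longrightarrow> y \<in> A \<Longrightarrow> (x, y) \<in> r \<longleftrightarrow> (F x, F y) \<in> r'"
    and surj: "\<And>z. z \<in> B \<Longrightarrow> \<exists>x\<in>A. (F x, z) \<in> r'"
  shows "\<exists>f. bij_betw f (A // r) (B // r')"
proof -
  define f where "f c = r' `` F ` (c \<inter> A)" for c
  have f: "f (r `` {x}) = r' `` {F x}" if x: "x \<in> A" for x
  proof
    show "f (r `` {x}) \<subseteq> r' `` {F x}"
    proof
      fix z assume "z \<in> f (r `` {x})"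
      then obtain y where y: "y \<in> A" "(x, y) \<in> r" "(F y, z) \<in> r'" unfolding f_def by auto
      then have "(F x, F y) \<in> r'" using iff x by blast
      then show "z \<in> r' `` {F x}" using y(3) r' by (meson Image_singleton_iff equivE transD)
    qed
    have "x \<in> r `` {x} \<inter> A" using x A equiv_class_self[OF r] by blast
    then show "r' `` {F x} \<subseteq> f (r `` {x})" unfolding f_def by blast
  qed
  have "bij_betw f (A // r) (B // r')"
    unfolding bij_betw_def
  proof
    show "inj_on f (A // r)"
    proof (rule inj_onI)
      fix c d assume "c \<in> A // r" "d \<in> A // r" and e: "f c = f d"
      then obtain x y where xy: "x \<in> A" "c = r `` {x}" "y \<in> A" "d = r `` {y}"
        by (auto elim!: quotientE)
      then have "r' `` {F x} = r' `` {F y}" using e f by simp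
      then have "(F x, F y) \<in> r'" using eq_equiv_class[OF _ r'] F xy B by blast
      then show "c = d" using iff xy equiv_class_eq[OF r] by blast
    qed
    show "f ` (A // r) = B // r'"
    proof (intro equalityI subsetI)
      fix c assume "c \<in> f ` (A // r)"
      then obtain x where "x \<in> A" "c = r' `` {F x}" using f by (auto elim!: quotientE)
      then show "c \<in> B // r'" using F by (auto intro: quotientI)
    next
      fix c assume "c \<in> B // r'"
      then obtain z where z: "z \<in> B" "c = r' `` {z}" by (auto elim!: quotientE)
      obtain x where x: "x \<in> A" "(F x, z) \<in> r'" using surj[OF z(1)] by blast
      then have "c = f (r `` {x})" using f z equiv_class_eq[OF r'] by simp
      then show "c \<in> f ` (A // r)" using x(1) by (auto intro: quotientI)
    qed
  qed
  then show ?thesis by blast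
qed

text \<open>The hypothesis on \<open>n\<close> and \<open>d\<close> is what the pair \<open>(q r, (q - 1) r)\<close> satisfies. The bijection
appends \<open>u\<close> copies of the simplex columns to a chosen column list of the code; the class of the
result is independent of the choice.\<close>

lemma lcd_classes_bijection:
  assumes q: "CARD('a :: {field, finite}) = 2 \<and> k \<ge> 3 \<or> CARD('a) = 3 \<and> k \<ge> 2"
    and nd: "CARD('a) * d = (CARD('a) - 1) * n"
  shows "\<exists>f. bij_betw f ((lcd_codes_dual2 n k d :: 'a vec set set) // code_equiv n k)
    ((lcd_codes_dual2 (n + q_bracket CARD('a) k * u) k (d + CARD('a) ^ (k - 1) * u) :: 'a vec set set)
      // code_equiv (n + q_bracket CARD('a) k * u) k)"
proof -
  let ?n' = "n + q_bracket CARD('a) k * u" and ?d' = "d + CARD('a) ^ (k - 1) * u"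
  let ?A = "lcd_codes_dual2 n k d :: 'a vec set set" and ?B = "lcd_codes_dual2 ?n' k ?d' :: 'a vec set set"
  let ?U = "concat (replicate u (simplex_columns k)) :: 'a vec list"
  define cols where "cols C = (SOME vs. length vs = n \<and> lcd_columns k d vs \<and> 0\<^sub>v k \<notin> set vs \<and> C = code k vs)"
    for C :: "'a vec set"
  have cols: "length (cols C) = n" "lcd_columns k d (cols C)" "0\<^sub>v k \<notin> set (cols C)" "C = code k (cols C)"
    if "C \<in> ?A" for C
  proof -
    obtain vs where "length vs = n \<and> lcd_columns k d vs \<and> 0\<^sub>v k \<notin> set vs \<and> C = code k vs"
      using lcd_codes_dual2_columns[OF \<open>C \<in> ?A\<close>] by blast
    then have "length (cols C) = n \<and> lcd_columns k d (cols C) \<and> 0\<^sub>v k \<notin> set (cols C) \<and> C = code k (cols C)"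
      unfolding cols_def by (rule someI)
    then show "length (cols C) = n" "lcd_columns k d (cols C)" "0\<^sub>v k \<notin> set (cols C)" "C = code k (cols C)"
      by blast+
  qed
  have U: "set ?U \<subseteq> carrier_vec k - {0\<^sub>v k}"
    using simplex_columns(1)[of k] by (intro set_copies_subset) blast
  have ext: "length (vs @ ?U) = ?n'" "lcd_columns k ?d' (vs @ ?U)" "0\<^sub>v k \<notin> set vs \<Longrightarrow> 0\<^sub>v k \<notin> set (vs @ ?U)"
    if "length vs = n" "lcd_columns k d vs" for vs :: "'a vec list"
    using that U lcd_columns_add_simplex[OF q, of d u vs]
    by (auto simp: length_simplex_columns mult.commute)
  have equiv_iff: "(code k vs, code k ws) \<in> code_equiv m k \<longleftrightarrow> columns_equiv k vs ws"
    if "length vs = m" "length ws = m" "lcd_columns k e vs" "lcd_columns k e ws"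
    for m e and vs ws :: "'a vec list"
    using that nondegenerate_inj columns_equiv_imp_code_equiv code_equiv_imp_columns_equiv
    unfolding lcd_columns_def by metis
  define F where "F C = code k (cols C @ ?U)" for C
  show ?thesis
  proof (rule quotient_bijection[OF equiv_code_equiv equiv_code_equiv, where F = F])
    show "?A \<subseteq> {C. linear_code n k C}" "?B \<subseteq> {C. linear_code ?n' k C}"
      by (auto simp: lcd_codes_dual2_def lcd_codes_def)
    show "F C \<in> ?B" if "C \<in> ?A" for C
      unfolding F_def using ext cols[OF that] by (intro code_mem_lcd_codes_dual2) blast+
    show "(C, C') \<in> code_equiv n k \<longleftrightarrow> (F C, F C') \<in> code_equiv ?n' k" if C: "C \<in> ?A" "C' \<in> ?A" for C C'
    proof -
      note c = cols[OF C(1)] and c' = cols[OF C(2)]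
      have "(C, C') \<in> code_equiv n k \<longleftrightarrow> columns_equiv k (cols C) (cols C')"
        using equiv_iff[OF c(1) c'(1) c(2) c'(2)] c(4) c'(4) by simp
      also have "\<dots> \<longleftrightarrow> columns_equiv k (cols C @ ?U) (cols C' @ ?U)"
        by (rule columns_equiv_add_simplex[symmetric])
      also have "\<dots> \<longleftrightarrow> (F C, F C') \<in> code_equiv ?n' k"
        unfolding F_def using ext(1,2)[OF c(1,2)] ext(1,2)[OF c'(1,2)] by (intro equiv_iff[symmetric])
      finally show ?thesis .
    qed
    fix D assume D: "D \<in> ?B"
    obtain ws where ws: "length ws = ?n'" "lcd_columns k ?d' ws" "0\<^sub>v k \<notin> set ws" "D = code k ws"
      using lcd_codes_dual2_columns[OF D] by blast
    have wsc: "set ws \<subseteq> carrier_vec k" using ws(2) unfolding lcd_columns_def by blast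
    have W: "filter (\<lambda>v. v \<noteq> 0\<^sub>v k) ws = ws" using ws(3) by (intro filter_True) auto
    have mult: "u \<le> count (mset (map projpoint ws)) (projpoint p)" if "p \<in> carrier_vec k - {0\<^sub>v k}" for p
      by (rule add_leD1, rule simplex_multiplicity[OF ws(2,1) nd _ that]) (use q in auto)
    \<comment> \<open>a preimage of the class of \<open>D\<close>: the bound on multiplicities allows \<open>u\<close> copies to be removed from \<open>ws\<close>\<close>
    obtain vs where vs: "set vs \<subseteq> carrier_vec k - {0\<^sub>v k}"
      "mset (map projpoint (vs @ ?U)) = mset (map projpoint ws)"
      "length vs + q_bracket CARD('a) k * u = length ws"
      by (rule lcd_columns_remove_simplex[OF q wsc mult, unfolded W])
    have len: "length vs = n" using vs(3) ws(1) by simp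
    have "set (vs @ ?U) \<subseteq> carrier_vec k" using vs(1) U by auto
    then have "lcd_columns k ?d' (vs @ ?U) \<longleftrightarrow> lcd_columns k ?d' ws"
      using lcd_columns_cong[OF _ wsc] weight_cong[OF _ wsc vs(2)] gram_cong[OF _ _ wsc vs(2)] q by blast
    then have lvs: "lcd_columns k d vs" using ws(2) lcd_columns_add_simplex[OF q] by blast
    have A: "code k vs \<in> ?A" by (rule code_mem_lcd_codes_dual2[OF lvs len]) (use vs(1) in blast)
    note c = cols[OF A]
    have "linear_code n k (code k vs)" using A by (simp add: lcd_codes_dual2_def lcd_codes_def)
    then have "(code k vs, code k vs) \<in> code_equiv n k"
      using equiv_class_self[OF equiv_code_equiv, of "code k vs" n k] by simp
    then have "(code k (cols (code k vs)), code k vs) \<in> code_equiv n k" unfolding c(4)[symmetric] .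
    then have "columns_equiv k (cols (code k vs)) vs" using equiv_iff[OF c(1) len c(2) lvs] by blast
    then have "columns_equiv k (cols (code k vs) @ ?U) (vs @ ?U)" by (simp only: columns_equiv_add_simplex)
    then have 1: "(F (code k vs), code k (vs @ ?U)) \<in> code_equiv ?n' k"
      unfolding F_def using equiv_iff[OF ext(1)[OF c(1,2)] ext(1)[OF len lvs] ext(2)[OF c(1,2)] ext(2)[OF len lvs]] by blast
    have "columns_equiv k (vs @ ?U) ws" by (rule columns_equiv_same_points) (use vs(2) in simp)
    then have 2: "(code k (vs @ ?U), D) \<in> code_equiv ?n' k"
      using equiv_iff[OF ext(1)[OF len lvs] ws(1) ext(2)[OF len lvs] ws(2)] ws(4) by blast
    have "(F (code k vs), D) \<in> code_equiv ?n' k"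
      using 1 2 equiv_code_equiv by (meson equivE transD)
    then show "\<exists>C\<in>?A. (F C, D) \<in> code_equiv ?n' k" using A by blast
  qed
qed

section \<open>Eliminating zero coordinates\<close>

text \<open>The columns are the points of the affine hyperplane \<open>v \<bullet> \<phi> = 1\<close>; they generate a first-order
Reed-Muller code. A message that is not a multiple of \<open>\<phi>\<close> meets the proportion \<open>(q - 1) / q\<close> of
them, a nonzero multiple of \<open>\<phi>\<close> meets all.\<close>

lemma ex_affine_columns:
  fixes \<phi> :: "'a :: {field, finite} vec"
  assumes \<phi>: "\<phi> \<in> carrier_vec k" "\<phi> \<noteq> 0\<^sub>v k"
  obtains R where "set R \<subseteq> carrier_vec k - {0\<^sub>v k}" "CARD('a) * length R = CARD('a) ^ k"
    "\<And>x. x \<in> carrier_vec k \<Longrightarrow> (\<And>c. x \<noteq> c \<cdot>\<^sub>v \<phi>) \<Longrightarrow>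
       CARD('a) * CARD('a) * weight R x = (CARD('a) - 1) * CARD('a) ^ k"
    "\<And>x. x \<in> carrier_vec k \<Longrightarrow> x \<noteq> 0\<^sub>v k \<Longrightarrow>
       CARD('a) * CARD('a) * weight R x \<ge> (CARD('a) - 1) * CARD('a) ^ k"
proof -
  let ?q = "CARD('a)" and ?A = "{v \<in> carrier_vec k. v \<bullet> \<phi> = 1}"
  have fin: "finite ?A" using finite_carrier_vec by simp
  then obtain R where R: "set R = ?A" "distinct R" using finite_distinct_list by blast
  have cardA: "?q * card ?A = ?q ^ k" by (rule card_hyperplane(1)[OF \<phi>])
  have w: "weight R x = card {v \<in> carrier_vec k. v \<bullet> \<phi> = 1 \<and> v \<bullet> x \<noteq> 0}" for x
  proof -
    have "weight R x = (\<Sum>v\<in>?A. of_bool (v \<bullet> x \<noteq> 0))"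
      unfolding weight_def using R by (simp add: sum_list_distinct_conv_sum_set)
    also have "\<dots> = card {v \<in> ?A. v \<bullet> x \<noteq> 0}"
      using fin by (simp add: of_bool_def sum.If_cases Int_def)
    finally show ?thesis by (simp add: conj_assoc)
  qed
  have *: "?q * ?q * weight R x = (?q - 1) * ?q ^ k"
    if "x \<in> carrier_vec k" "\<And>c. x \<noteq> c \<cdot>\<^sub>v \<phi>" for x
  proof -
    have "?q * weight R x = (?q - 1) * card ?A"
      unfolding w by (rule card_two_conditions[OF that(1) \<phi>(1) that(2)])
    then have "?q * ?q * weight R x = (?q - 1) * (?q * card ?A)"
      by (simp only: mult.assoc mult.left_commute[of ?q "?q - 1"])
    then show ?thesis unfolding cardA .
  qed
  show thesis
  proof (rule that[of R])
    show "set R \<subseteq> carrier_vec k - {0\<^sub>v k}" using R \<phi> by auto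
    show "?q * length R = ?q ^ k" using cardA R distinct_card by metis
    show "?q * ?q * weight R x \<ge> (?q - 1) * ?q ^ k" if x: "x \<in> carrier_vec k" "x \<noteq> 0\<^sub>v k" for x
    proof (cases "\<forall>c. x \<noteq> c \<cdot>\<^sub>v \<phi>")
      case False
      then obtain c where c: "x = c \<cdot>\<^sub>v \<phi>" by blast
      with x \<phi> have "c \<noteq> 0" by auto
      then have "{v \<in> carrier_vec k. v \<bullet> \<phi> = 1 \<and> v \<bullet> x \<noteq> 0} = ?A" using c \<phi> by auto
      then have "?q * ?q * weight R x = ?q * ?q ^ k"
        unfolding w by (simp only: mult.assoc cardA)
      moreover have "(?q - 1) * ?q ^ k \<le> ?q * ?q ^ k" by (rule mult_le_mono1) simp
      ultimately show ?thesis by linarith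
    qed (use * x in auto)
  qed (use * in blast)
qed

text \<open>The line spanned by \<open>x\<close> has at most \<open>q\<close> points and cannot fill a space of \<open>q^k\<close> points.\<close>

lemma ex_not_proportional:
  fixes x :: "'a :: {field, finite} vec"
  assumes k: "k \<ge> 2" and x: "x \<in> carrier_vec k - {0\<^sub>v k}"
  shows "\<exists>\<phi>\<in>carrier_vec k - {0\<^sub>v k}. \<forall>c. x \<noteq> c \<cdot>\<^sub>v \<phi>"
proof -
  have "card (range (\<lambda>c. c \<cdot>\<^sub>v x)) \<le> CARD('a)" by (rule card_image_le) simp
  also have "\<dots> < CARD('a) ^ k"
    using power_strict_increasing[of 1 k "CARD('a)"] k card_field_gt_1[where 'a = 'a] by simp
  finally have "\<not> carrier_vec k \<subseteq> range (\<lambda>c. c \<cdot>\<^sub>v x)"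
    using card_mono[of "range (\<lambda>c. c \<cdot>\<^sub>v x)" "carrier_vec k"] by (auto simp: card_carrier_vec)
  then obtain \<phi> where \<phi>: "\<phi> \<in> carrier_vec k" "\<And>c. \<phi> \<noteq> c \<cdot>\<^sub>v x" by blast
  have "\<phi> \<noteq> 0\<^sub>v k" using \<phi>(2)[of 0] x by (auto intro!: eq_vecI)
  moreover have "x \<noteq> c \<cdot>\<^sub>v \<phi>" for c
  proof
    assume e: "x = c \<cdot>\<^sub>v \<phi>"
    then have "c \<noteq> 0" using x \<phi>(1) by auto
    then have "\<phi> = (1 / c) \<cdot>\<^sub>v x" using e by (simp add: smult_smult_assoc)
    then show False using \<phi>(2) by blast
  qed
  ultimately show ?thesis using \<phi>(1) by blast
qed

text \<open>Zero columns are traded for nonzero ones. They raise all point multiplicities, so that extra copies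
of the simplex columns can be removed together with them. Copies of an affine hyperplane, chosen
with respect to a message of minimum weight, then restore length and minimum weight without
changing the Gram form.\<close>

lemma lcd_code_imp_lcd_code_dual2:
  assumes q: "CARD('a :: {field, finite}) = 2 \<and> k \<ge> 3 \<or> CARD('a) = 3 \<and> k \<ge> 2"
    and nd: "CARD('a) * d = (CARD('a) - 1) * n"
    and C: "(C :: 'a vec set) \<in> lcd_codes (n + q_bracket CARD('a) k * u) k (d + CARD('a) ^ (k - 1) * u)"
  shows "(lcd_codes_dual2 n k d :: 'a vec set set) \<noteq> {}"
proof -
  let ?q = "CARD('a)" and ?Q = "CARD('a) ^ (k - 1)"
  have q1: "?q > 1" by (rule card_field_gt_1)
  have k: "k \<ge> 2" using q by auto
  have Qk: "?q ^ k = ?q * ?Q" using k by (simp flip: power_Suc)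
  obtain ws where ws: "length ws = n + q_bracket ?q k * u" "lcd_columns k (d + ?Q * u) ws"
      "C = code k ws"
    by (rule lcd_codes_columns[OF C])
  have wsc: "set ws \<subseteq> carrier_vec k" using ws(2) unfolding lcd_columns_def by blast
  define z where "z = length ws - length (filter (\<lambda>v. v \<noteq> 0\<^sub>v k) ws)"
  have z: "length (filter (\<lambda>v. v \<noteq> 0\<^sub>v k) ws) + z = length ws"
    unfolding z_def using length_filter_le[of "\<lambda>v. v \<noteq> 0\<^sub>v k" ws] by linarith
  \<comment> \<open>the zero columns make room for \<open>(q - 1) z\<close> further copies of the simplex columns\<close>
  have mult: "u + (?q - 1) * z \<le> count (mset (map projpoint ws)) (projpoint p)"
    if "p \<in> carrier_vec k - {0\<^sub>v k}" for p
    unfolding z_def using simplex_multiplicity[OF ws(2,1) nd _ that] k by simp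
  obtain vs where vs: "set vs \<subseteq> carrier_vec k - {0\<^sub>v k}"
    "mset (map projpoint (vs @ concat (replicate (u + (?q - 1) * z) (simplex_columns k))))
       = mset (map projpoint (filter (\<lambda>v. v \<noteq> 0\<^sub>v k) ws))"
    "length vs + q_bracket ?q k * (u + (?q - 1) * z) = length (filter (\<lambda>v. v \<noteq> 0\<^sub>v k) ws)"
    "\<forall>x\<in>carrier_vec k - {0\<^sub>v k}. weight vs x + ?Q * (u + (?q - 1) * z) = weight ws x"
    "\<forall>x\<in>carrier_vec k. \<forall>y\<in>carrier_vec k. gram vs x y = gram ws x y"
    by (rule lcd_columns_remove_simplex[OF q wsc mult])
  obtain x0 where x0: "x0 \<in> carrier_vec k - {0\<^sub>v k}" "weight ws x0 = d + ?Q * u"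
    using ws(2) unfolding lcd_columns_def by blast
  obtain \<phi> where \<phi>: "\<phi> \<in> carrier_vec k" "\<phi> \<noteq> 0\<^sub>v k" "\<And>c. x0 \<noteq> c \<cdot>\<^sub>v \<phi>"
    using ex_not_proportional[OF k x0(1)] by blast
  obtain R where R: "set R \<subseteq> carrier_vec k - {0\<^sub>v k}" "?q * length R = ?q ^ k"
    "\<And>x. x \<in> carrier_vec k \<Longrightarrow> (\<And>c. x \<noteq> c \<cdot>\<^sub>v \<phi>) \<Longrightarrow> ?q * ?q * weight R x = (?q - 1) * ?q ^ k"
    "\<And>x. x \<in> carrier_vec k \<Longrightarrow> x \<noteq> 0\<^sub>v k \<Longrightarrow> ?q * ?q * weight R x \<ge> (?q - 1) * ?q ^ k"
    by (rule ex_affine_columns[OF \<phi>(1,2)]) blast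
  have shift: "(?q - 1) * ?q ^ k = ?q * ((?q - 1) * ?Q)" unfolding Qk by (rule mult.left_commute)
  have Req: "?q * weight R x0 = (?q - 1) * ?Q"
    using R(3)[of x0] x0(1) \<phi>(3) q1 unfolding shift mult.assoc by simp
  have Rge: "?q * weight R x \<ge> (?q - 1) * ?Q" if "x \<in> carrier_vec k - {0\<^sub>v k}" for x
    using R(4)[of x] that q1 unfolding shift mult.assoc by simp
  \<comment> \<open>\<open>q z\<close> copies of \<open>q^(k-1)\<close> columns replace the \<open>z\<close> zero columns and the \<open>(q^k - 1) z\<close> columns of the extra simplex copies\<close>
  define us where "us = vs @ concat (replicate (?q * z) R)"
  have us: "set us \<subseteq> carrier_vec k - {0\<^sub>v k}"
    unfolding us_def using vs(1) set_copies_subset[OF R(1)] by auto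
  have "length us = n"
  proof -
    define b m where "b = q_bracket ?q k" and "m = ?q - 1"
    have "length us = length vs + z * ?q ^ k" unfolding us_def R(2)[symmetric] by simp
    also have "?q ^ k = m * b + 1" using q_bracket_mult[where 'a = 'a and k = k] q1 unfolding b_def m_def by simp
    finally have "length us + b * u = length vs + z * (m * b + 1) + b * u" by simp
    also have "\<dots> = length vs + b * (u + m * z) + z"
      by (simp add: algebra_simps)
    finally have "length us + b * u = length ws"
      using vs(3) z unfolding b_def m_def by simp
    then have "length us + q_bracket ?q k * u = length ws" unfolding b_def .
    then show ?thesis using ws(1) by simp
  qed
  have wt: "weight us x = weight vs x + z * (?q * weight R x)" for x unfolding us_def by simp
  have gr: "gram us x y = gram ws x y" if "x \<in> carrier_vec k" "y \<in> carrier_vec k" for x y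
  proof -
    have "gram us x y = gram vs x y + of_nat (?q * z) * gram R x y" unfolding us_def by simp
    also have "of_nat (?q * z) = (0 :: 'a)" unfolding of_nat_mult of_nat_card_field by simp
    finally show ?thesis using vs(5) that by simp
  qed
  have expand: "?Q * (u + (?q - 1) * z) = ?Q * u + z * ((?q - 1) * ?Q)" by (simp add: distrib_left)
  have "lcd_columns k d us"
    unfolding lcd_columns_def
  proof (intro conjI ballI)
    show "set us \<subseteq> carrier_vec k" using us by blast
    have "nondegenerate k ws" using ws(2) unfolding lcd_columns_def by blast
    then show "nondegenerate k us" using nondegenerate_cong[OF gr] by blast
    show "d \<le> weight us x" if x: "x \<in> carrier_vec k - {0\<^sub>v k}" for x
    proof -
      have "d + ?Q * u \<le> weight ws x" using ws(2) x unfolding lcd_columns_def by blast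
      moreover have "z * ((?q - 1) * ?Q) \<le> z * (?q * weight R x)" using Rge[OF x] by (rule mult_le_mono2)
      ultimately show ?thesis using bspec[OF vs(4) x] unfolding wt expand by linarith
    qed
    have "weight us x0 = d" using bspec[OF vs(4) x0(1)] x0(2) unfolding wt Req expand by linarith
    then show "\<exists>x\<in>carrier_vec k - {0\<^sub>v k}. weight us x = d" using x0(1) by blast
  qed
  then have "code k us \<in> lcd_codes_dual2 n k d"
    using \<open>length us = n\<close> us by (intro code_mem_lcd_codes_dual2) blast+
  then show ?thesis by blast
qed

section \<open>The classification theorem\<close>

theorem theorem4p7:
  fixes q k0 k t :: nat and \<alpha> :: "nat \<Rightarrow> int" and r s' :: int
  assumes q_k0: "(q, k0) \<in> {(2, 3), (3, 2)}"
    and card_field: "card (UNIV :: 'a :: {field, finite} set) = q"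
    and k: "k0 \<le> k"
    and t: "t < q_bracket q k"
    and r: "r = int (q ^ (k - 1) * t) - int (q_bracket q k) * \<alpha> t"
    and s': "s' = (int q * r - int t) div int (q_bracket q k) + 1"
    and qr: "int q * r \<ge> int k"
  shows
    "((\<forall>s::nat. int (q ^ (k - 1)) * int (q_bracket q k * s + t)
         - int (q_bracket q k) * (int (q ^ (k - 1) * s) + \<alpha> t) = r)
      \<and> int (q_bracket q k) dvd int q * r - int t
      \<and> int q * r = int (q_bracket q k) * (s' - 1) + int t
      \<and> (int q - 1) * r = int (q ^ (k - 1)) * (s' - 1) + \<alpha> t)
   \<and> (\<forall>s::nat. int s \<ge> s' \<longrightarrow>
       (\<exists>f. bij_betw f
          ((lcd_codes_dual2 (nat (int q * r)) k (nat ((int q - 1) * r)) :: 'a vec set set)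
             // code_equiv (nat (int q * r)) k)
          ((lcd_codes_dual2 (q_bracket q k * s + t) k (nat (int (q ^ (k - 1) * s) + \<alpha> t))
              :: 'a vec set set)
             // code_equiv (q_bracket q k * s + t) k)))
   \<and> ((lcd_codes_dual2 (nat (int q * r)) k (nat ((int q - 1) * r)) :: 'a vec set set) = {} \<longrightarrow>
       (\<forall>s::nat. int s \<ge> s' \<longrightarrow>
          (lcd_codes (q_bracket q k * s + t) k (nat (int (q ^ (k - 1) * s) + \<alpha> t))
             :: 'a vec set set) = {}))"
proof -
  have qk: "CARD('a) = 2 \<and> k \<ge> 3 \<or> CARD('a) = 3 \<and> k \<ge> 2"
    using q_k0 card_field k by auto
  define K P where "K = int (q_bracket q k)" and "P = int (q ^ (k - 1))"
  have q1: "q > 1" and k1: "k \<ge> 1" using q_k0 k by auto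
  have K0: "K > 0" using t unfolding K_def by simp
  have "(q - 1) * q_bracket q k + 1 = q * q ^ (k - 1)"
    using q_bracket_mult[where 'a = 'a and k = k] q1 k1 unfolding card_field by (simp flip: power_Suc)
  then have "int ((q - 1) * q_bracket q k + 1) = int (q * q ^ (k - 1))" by simp
  then have QP: "int q * P = (int q - 1) * K + 1" using q1 unfolding K_def P_def by (simp add: of_nat_diff)
  have r': "r = P * int t - K * \<alpha> t" unfolding r K_def P_def by simp
  \<comment> \<open>the number \<open>s' - 1\<close> in closed form, so that no division remains\<close>
  define m where "m = (int q - 1) * int t - int q * \<alpha> t"
  have "int q * r = (int q * P) * int t - int q * K * \<alpha> t" unfolding r' by (simp add: algebra_simps)
  then have qrm: "int q * r = K * m + int t" unfolding QP m_def by (simp add: algebra_simps)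
  then have s'm: "s' - 1 = m" unfolding s' K_def[symmetric] using K0 by simp
  have "P * m + \<alpha> t = (int q - 1) * P * int t - (int q * P) * \<alpha> t + \<alpha> t"
    unfolding m_def by (simp add: algebra_simps)
  also have "\<dots> = (int q - 1) * r" unfolding QP r' by (simp add: algebra_simps)
  finally have q1r: "(int q - 1) * r = P * m + \<alpha> t" ..
  \<comment> \<open>needed to pass from the integers \<open>q r\<close> and \<open>(q - 1) r\<close> to natural numbers\<close>
  have r0: "r > 0"
  proof (rule ccontr)
    assume "\<not> r > 0"
    then have "int q * r \<le> 0" by (simp add: mult_nonneg_nonpos)
    then show False using qr k1 by simp
  qed
  let ?n = "nat (int q * r)" and ?d = "nat ((int q - 1) * r)"
  have n: "int ?n = int q * r" and d: "int ?d = (int q - 1) * r" using r0 q1 by auto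
  have nd: "CARD('a) * ?d = (CARD('a) - 1) * ?n"
  proof -
    have "int (q * ?d) = int ((q - 1) * ?n)" using q1 n d by (simp add: of_nat_diff)
    then show ?thesis unfolding card_field by (simp only: of_nat_eq_iff)
  qed
  have param: "q_bracket q k * s + t = ?n + q_bracket q k * nat (int s - m)"
    "nat (int (q ^ (k - 1) * s) + \<alpha> t) = ?d + q ^ (k - 1) * nat (int s - m)"
    if s: "int s \<ge> s'" for s :: nat
  proof -
    have u: "int (nat (int s - m)) = int s - m" using s s'm by simp
    have "int (q_bracket q k * s + t) = int (?n + q_bracket q k * nat (int s - m))"
      unfolding of_nat_add of_nat_mult u n unfolding qrm K_def[symmetric] by (simp add: algebra_simps)
    then show "q_bracket q k * s + t = ?n + q_bracket q k * nat (int s - m)" by (simp only: of_nat_eq_iff)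
    have "int (q ^ (k - 1) * s) + \<alpha> t = int (?d + q ^ (k - 1) * nat (int s - m))"
      unfolding of_nat_add of_nat_mult u d unfolding q1r P_def[symmetric] by (simp add: algebra_simps)
    then show "nat (int (q ^ (k - 1) * s) + \<alpha> t) = ?d + q ^ (k - 1) * nat (int s - m)"
      by (simp only: nat_int)
  qed
  show ?thesis
  proof (intro conjI allI impI)
    fix s :: nat
    show "int (q ^ (k - 1)) * int (q_bracket q k * s + t)
         - int (q_bracket q k) * (int (q ^ (k - 1) * s) + \<alpha> t) = r"
      unfolding of_nat_mult of_nat_add K_def[symmetric] P_def[symmetric] r' by (simp add: algebra_simps)
  next
    show "int (q_bracket q k) dvd int q * r - int t" unfolding qrm K_def[symmetric] by simp
    show "int q * r = int (q_bracket q k) * (s' - 1) + int t" unfolding s'm qrm K_def ..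
    show "(int q - 1) * r = int (q ^ (k - 1)) * (s' - 1) + \<alpha> t" unfolding s'm q1r P_def ..
  next
    fix s :: nat assume s: "int s \<ge> s'"
    show "\<exists>f. bij_betw f ((lcd_codes_dual2 ?n k ?d :: 'a vec set set) // code_equiv ?n k)
          ((lcd_codes_dual2 (q_bracket q k * s + t) k (nat (int (q ^ (k - 1) * s) + \<alpha> t))
              :: 'a vec set set) // code_equiv (q_bracket q k * s + t) k)"
      unfolding param[OF s] by (rule lcd_classes_bijection[OF qk nd, unfolded card_field])
  next
    fix s :: nat
    assume empty: "(lcd_codes_dual2 ?n k ?d :: 'a vec set set) = {}" and s: "int s \<ge> s'"
    show "(lcd_codes (q_bracket q k * s + t) k (nat (int (q ^ (k - 1) * s) + \<alpha> t)) :: 'a vec set set) = {}"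
      unfolding param[OF s]
      using lcd_code_imp_lcd_code_dual2[OF qk nd, unfolded card_field] empty by blast
  qed
qed

end
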